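(* Let $R$ be a commutative noetherian local ring and let $M$ be a finitely generated $R$-module of positive grade. Then $$\bigcap_{i>0}\operatorname{rad}(\operatorname{Ann}_R\operatorname{Ext}^i_R(M,R))=\operatorname{rad}(\operatorname{Ann}_R(M)).$$
   Context: The grade of $M$ is $\inf\{i:\operatorname{Ext}^i_R(M,R)\neq 0\}$; $M$ has positive grade if $\operatorname{Hom}_R(M,R)=0$. $\operatorname{rad}$ denotes the radical of an ideal. (The left-hand side is denoted $\gamma(M)$ in the source.) *)

theory Defs
  imports "HOL-Algebra.Module" "HOL-Algebra.Ideal" "HOL-Algebra.AbelCoset"
    "HOL-Algebra.Ring_Divisibility" "HOL-Library.FSet"
begin

section \<open>Rings, ideals and modules\<close>

definition local_ring :: "('a, 'r) ring_scheme \<Rightarrow> bool" where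
  "local_ring R \<longleftrightarrow> cring R \<and> (\<exists>!\<mm>. maximalideal \<mm> R)"

definition radical :: "('a, 'r) ring_scheme \<Rightarrow> 'a set \<Rightarrow> 'a set" where
  "radical R I = {r \<in> carrier R. \<exists>n::nat. r [^]\<^bsub>R\<^esub> n \<in> I}"

definition annihilator ::
    "('a, 'r) ring_scheme \<Rightarrow> ('a, 'b, 'm) module_scheme \<Rightarrow> 'a set" where
  "annihilator R M = {r \<in> carrier R. \<forall>x\<in>carrier M. r \<odot>\<^bsub>M\<^esub> x = \<zero>\<^bsub>M\<^esub>}"

definition finitely_generated ::
    "('a, 'r) ring_scheme \<Rightarrow> ('a, 'b, 'm) module_scheme \<Rightarrow> bool" where
  "finitely_generated R M \<longleftrightarrow>
     (\<exists>A. finite A \<and> A \<subseteq> carrier M \<and>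
        (\<forall>x\<in>carrier M. \<exists>c\<in>A \<rightarrow> carrier R. x = (\<Oplus>\<^bsub>M\<^esub>a\<in>A. c a \<odot>\<^bsub>M\<^esub> a)))"

definition regular_module :: "('a, 'r) ring_scheme \<Rightarrow> ('a, 'a) module" where
  "regular_module R =
     \<lparr>carrier = carrier R, mult = mult R, one = one R, zero = zero R, add = add R,
      smult = mult R\<rparr>"

text \<open>
  The record \<open>module\<close> extends \<open>ring\<close>, but the locale \<open>module\<close> never looks at the fields
  \<open>mult\<close> and \<open>one\<close> of the module. In the modules constructed below these fields are left
  undefined.
\<close>

text \<open>
  Homomorphisms are extensional, so that each one is represented by exactly one function
  and the zero map is the only element of a vanishing \<open>Hom\<close>.
\<close>

definition hom_module ::
    "('a, 'r) ring_scheme \<Rightarrow> ('a, 'b, 'm) module_scheme \<Rightarrow> ('a, 'c, 'n) module_scheme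
       \<Rightarrow> ('a, 'b \<Rightarrow> 'c) module" where
  "hom_module R M N =
     \<lparr>carrier = {f \<in> carrier M \<rightarrow>\<^sub>E carrier N.
         (\<forall>x\<in>carrier M. \<forall>y\<in>carrier M. f (x \<oplus>\<^bsub>M\<^esub> y) = f x \<oplus>\<^bsub>N\<^esub> f y) \<and>
         (\<forall>a\<in>carrier R. \<forall>x\<in>carrier M. f (a \<odot>\<^bsub>M\<^esub> x) = a \<odot>\<^bsub>N\<^esub> f x)},
      mult = undefined, one = undefined,
      zero = (\<lambda>x\<in>carrier M. \<zero>\<^bsub>N\<^esub>),
      add = (\<lambda>f g. \<lambda>x\<in>carrier M. f x \<oplus>\<^bsub>N\<^esub> g x),
      smult = (\<lambda>a f. \<lambda>x\<in>carrier M. a \<odot>\<^bsub>N\<^esub> f x)\<rparr>"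

definition quotient_module ::
    "('a, 'b, 'm) module_scheme \<Rightarrow> 'b set \<Rightarrow> ('a, 'b set) module" where
  "quotient_module M N =
     \<lparr>carrier = a_rcosets\<^bsub>M\<^esub> N, mult = undefined, one = undefined,
      zero = N, add = set_add M,
      smult = (\<lambda>a X. \<Union>x\<in>X. N +>\<^bsub>M\<^esub> (a \<odot>\<^bsub>M\<^esub> x))\<rparr>"

definition positive_grade ::
    "('a, 'r) ring_scheme \<Rightarrow> ('a, 'b, 'm) module_scheme \<Rightarrow> bool" where
  "positive_grade R M \<longleftrightarrow>
     carrier (hom_module R M (regular_module R)) = {\<zero>\<^bsub>hom_module R M (regular_module R)\<^esub>}"


section \<open>The standard free resolution of a module\<close>

definition free_module :: "('a, 'r) ring_scheme \<Rightarrow> 'x set \<Rightarrow> ('a, 'x \<Rightarrow> 'a) module" where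
  "free_module R B =
     \<lparr>carrier = {f. (\<forall>x. f x \<in> carrier R) \<and> (\<forall>x. x \<notin> B \<longrightarrow> f x = \<zero>\<^bsub>R\<^esub>) \<and>
                    finite {x. f x \<noteq> \<zero>\<^bsub>R\<^esub>}},
      mult = undefined, one = undefined,
      zero = (\<lambda>_. \<zero>\<^bsub>R\<^esub>),
      add = (\<lambda>f g x. f x \<oplus>\<^bsub>R\<^esub> g x),
      smult = (\<lambda>a f x. a \<otimes>\<^bsub>R\<^esub> f x)\<rparr>"

text \<open>
  For \<open>K \<subseteq> carrier N\<close> and \<open>e\<close> injective on \<open>K\<close>, \<open>lin_ext R N e K\<close> is the linear map from
  the free module on \<open>e ` K\<close> to \<open>N\<close> that sends the basis element \<open>e k\<close> to \<open>k\<close>.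
\<close>

definition lin_ext ::
    "('a, 'r) ring_scheme \<Rightarrow> ('a, 'b, 'm) module_scheme \<Rightarrow> ('b \<Rightarrow> 'x) \<Rightarrow> 'b set
       \<Rightarrow> ('x \<Rightarrow> 'a) \<Rightarrow> 'b" where
  "lin_ext R N e K f = (\<Oplus>\<^bsub>N\<^esub>k\<in>{k \<in> K. f (e k) \<noteq> \<zero>\<^bsub>R\<^esub>}. f (e k) \<odot>\<^bsub>N\<^esub> k)"

text \<open>
  The resolution \<open>\<dots> \<rightarrow> F\<^sub>2 \<rightarrow> F\<^sub>1 \<rightarrow> F\<^sub>0 \<rightarrow> M \<rightarrow> 0\<close> is the tautological one: \<open>F\<^sub>0\<close> is free on
  the set of all elements of \<open>M\<close>, and \<open>F\<^sub>i\<^sub>+\<^sub>1\<close> is free on the set of all elements of the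
  kernel of the map out of \<open>F\<^sub>i\<close>. Taken literally, the type of \<open>F\<^sub>i\<close> would grow with \<open>i\<close>.
  To keep all \<open>F\<^sub>i\<close> in one type, basis elements are named by the following datatype:
  \<open>Gen x\<close> names \<open>x \<in> M\<close>, and \<open>Rel S\<close> names the finitely supported function whose graph,
  restricted to the support, is \<open>S\<close>.
\<close>

datatype ('a, 'b) label = Gen 'b | Rel "(('a, 'b) label \<times> 'a) fset"

definition rel_label ::
    "('a, 'r) ring_scheme \<Rightarrow> (('a, 'b) label \<Rightarrow> 'a) \<Rightarrow> ('a, 'b) label" where
  "rel_label R f = Rel (Abs_fset {(x, f x) | x. f x \<noteq> \<zero>\<^bsub>R\<^esub>})"

text \<open>
  \<open>syz R M i\<close> is the kernel of the map out of \<open>F\<^sub>i\<close>. Sums in \<open>F\<^sub>i\<close> are computed in the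
  free module on all labels, which contains every \<open>F\<^sub>i\<close>.
\<close>

primrec syz ::
    "('a, 'r) ring_scheme \<Rightarrow> ('a, 'b, 'm) module_scheme \<Rightarrow> nat \<Rightarrow> (('a, 'b) label \<Rightarrow> 'a) set" where
  "syz R M 0 =
     {f \<in> carrier (free_module R (Gen ` carrier M)). lin_ext R M Gen (carrier M) f = \<zero>\<^bsub>M\<^esub>}"
| "syz R M (Suc i) =
     {f \<in> carrier (free_module R (rel_label R ` syz R M i)).
        lin_ext R (free_module R UNIV) (rel_label R) (syz R M i) f = \<zero>\<^bsub>free_module R UNIV\<^esub>}"

primrec res_module ::
    "('a, 'r) ring_scheme \<Rightarrow> ('a, 'b, 'm) module_scheme \<Rightarrow> nat
       \<Rightarrow> ('a, ('a, 'b) label \<Rightarrow> 'a) module" where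
  "res_module R M 0 = free_module R (Gen ` carrier M)"
| "res_module R M (Suc i) = free_module R (rel_label R ` syz R M i)"

definition res_diff ::
    "('a, 'r) ring_scheme \<Rightarrow> ('a, 'b, 'm) module_scheme \<Rightarrow> nat
       \<Rightarrow> (('a, 'b) label \<Rightarrow> 'a) \<Rightarrow> (('a, 'b) label \<Rightarrow> 'a)" where
  \<comment> \<open>the differential from \<open>F\<^sub>i\<^sub>+\<^sub>1\<close> to \<open>F\<^sub>i\<close>\<close>
  "res_diff R M i = lin_ext R (free_module R UNIV) (rel_label R) (syz R M i)"


section \<open>Ext\<close>

text \<open>\<open>Ext R i M N\<close> is the cohomology in degree \<open>i\<close> of the complex
  \<open>Hom(F\<^sub>0, N) \<rightarrow> Hom(F\<^sub>1, N) \<rightarrow> \<dots>\<close>.\<close>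

definition cochain_module ::
    "('a, 'r) ring_scheme \<Rightarrow> nat \<Rightarrow> ('a, 'b, 'm) module_scheme \<Rightarrow> ('a, 'c, 'n) module_scheme
       \<Rightarrow> ('a, (('a, 'b) label \<Rightarrow> 'a) \<Rightarrow> 'c) module" where
  "cochain_module R i M N = hom_module R (res_module R M i) N"

definition cochain_diff ::
    "('a, 'r) ring_scheme \<Rightarrow> nat \<Rightarrow> ('a, 'b, 'm) module_scheme
       \<Rightarrow> ((('a, 'b) label \<Rightarrow> 'a) \<Rightarrow> 'c) \<Rightarrow> ((('a, 'b) label \<Rightarrow> 'a) \<Rightarrow> 'c)" where
  "cochain_diff R i M g = (\<lambda>f\<in>carrier (res_module R M (Suc i)). g (res_diff R M i f))"

definition cocycles ::
    "('a, 'r) ring_scheme \<Rightarrow> nat \<Rightarrow> ('a, 'b, 'm) module_scheme \<Rightarrow> ('a, 'c, 'n) module_scheme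
       \<Rightarrow> ((('a, 'b) label \<Rightarrow> 'a) \<Rightarrow> 'c) set" where
  "cocycles R i M N =
     {g \<in> carrier (cochain_module R i M N).
        cochain_diff R i M g = \<zero>\<^bsub>cochain_module R (Suc i) M N\<^esub>}"

primrec coboundaries ::
    "('a, 'r) ring_scheme \<Rightarrow> nat \<Rightarrow> ('a, 'b, 'm) module_scheme \<Rightarrow> ('a, 'c, 'n) module_scheme
       \<Rightarrow> ((('a, 'b) label \<Rightarrow> 'a) \<Rightarrow> 'c) set" where
  "coboundaries R 0 M N = {\<zero>\<^bsub>cochain_module R 0 M N\<^esub>}"
| "coboundaries R (Suc i) M N = cochain_diff R i M ` carrier (cochain_module R i M N)"

definition Ext ::
    "('a, 'r) ring_scheme \<Rightarrow> nat \<Rightarrow> ('a, 'b, 'm) module_scheme \<Rightarrow> ('a, 'c, 'n) module_scheme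
       \<Rightarrow> ('a, ((('a, 'b) label \<Rightarrow> 'a) \<Rightarrow> 'c) set) module" where
  "Ext R i M N =
     quotient_module ((cochain_module R i M N)\<lparr>carrier := cocycles R i M N\<rparr>)
       (coboundaries R i M N)"

end

theory Submission
  imports Defs
begin

text \<open>
  If \<open>a\<close> annihilates \<open>M\<close>, multiplication by \<open>a\<close> on the resolution is homotopic to zero, so \<open>a\<close>
  annihilates every \<open>Ext\<^sup>i(M, R)\<close>.

  Conversely, let powers of \<open>r\<close> annihilate all \<open>Ext\<^sup>i(M, R)\<close>, \<open>i > 0\<close>; for \<open>i = 0\<close> this is the assumption
  on the grade. Among the ideals \<open>J \<subseteq> Ann M\<close> such that every \<open>Ext\<^sup>i(M, R/J)\<close> is annihilated by a
  power of \<open>r\<close>, choose a maximal one, and let \<open>J'\<close> be the \<open>r\<close>-saturation of \<open>J\<close>. If some \<open>x \<in> Ann M\<close> is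
  regular on \<open>R/J'\<close>, then \<open>J + xR\<close> is again such an ideal, so \<open>x \<in> J\<close>, which forces \<open>1 \<in> J'\<close>, that is,
  a power of \<open>r\<close> lies in \<open>J \<subseteq> Ann M\<close>. Otherwise \<open>Ann M\<close> is contained in an associated prime
  \<open>P = (J' : b)\<close> of \<open>R/J'\<close>, and composing a nonzero map \<open>M \<rightarrow> R/P\<close> with multiplication by \<open>b\<close> gives a
  map \<open>M \<rightarrow> R/J'\<close> that is not \<open>r\<close>-torsion, a contradiction.

  Localization is avoided by working up to \<open>r\<close>-torsion, and \<open>Ext\<^sup>i(M, R/J)\<close> is never formed: as the
  resolution is free, cochains with values in \<open>R/J\<close> are represented by functions from the basis
  labels to \<open>R\<close>, taken modulo \<open>J\<close>.
\<close>

section \<open>Colon ideals and associated primes\<close>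

text \<open>The model is the argument over the ring R_r obtained by inverting r. If M_r were
  nonzero, a maximal regular sequence in its annihilator, of length d, would identify Ext^d(M_r,
  R_r) with Hom of M_r into R_r modulo the sequence, and the latter is nonzero. The maximal ideal J
  plays the part of the ideal generated by that sequence, so that neither the sequence nor its
  length has to be constructed. The price of staying over R is that vanishing becomes annihilation
  by a power of r. The exponent may depend on the degree and grows whenever an element x is
  adjoined; hence it is quantified separately in each degree, and no uniform bound is kept.
  Adjoining x makes degree i for J + xR depend on degrees i and i + 1 for J, as in the long exact
  sequence. This is why all degrees have to be carried along, although the contradiction is read off
  in degree 0 alone. The saturation J' is needed because x can only be chosen regular up to
  r-torsion: R/J' is R/J without its r-torsion.\<close>

text \<open>A nonempty chain of ideals of a noetherian ring contains its own union, so Zorn's lemma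
  applies to an arbitrary family of ideals, closed under unions or not.\<close>

lemma (in noetherian_ring) ex_maximal_ideal:
  assumes "\<S> \<noteq> {}" and "\<And>J. J \<in> \<S> \<Longrightarrow> ideal J R"
  shows "\<exists>J\<in>\<S>. \<forall>K\<in>\<S>. J \<subseteq> K \<longrightarrow> K = J"
proof (rule subset_Zorn_nonempty[OF assms(1)])
  fix C assume C: "C \<noteq> {}" "subset.chain \<S> C"
  have "subset.chain {I. ideal I R} C"
    using C(2) assms(2) unfolding subset.chain_def by blast
  from ideal_chain_is_trivial[OF C(1) this] C(2) show "\<Union>C \<in> \<S>"
    unfolding subset.chain_def by blast
qed

text \<open>The annihilator of the class of \<open>b\<close> in R/J. When prime and \<open>b\<close>
  is outside \<open>J\<close>, it is an associated prime of R/J; the equation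
  \<open>colon R J x = J\<close> says that \<open>x\<close> is regular on R/J.\<close>

definition colon :: "('a, 'r) ring_scheme \<Rightarrow> 'a set \<Rightarrow> 'a \<Rightarrow> 'a set" where
  "colon R J b = {a \<in> carrier R. a \<otimes>\<^bsub>R\<^esub> b \<in> J}"

lemma (in cring) ideal_colon:
  assumes "ideal J R" "b \<in> carrier R"
  shows "ideal (colon R J b) R"
proof -
  interpret J: ideal J R by fact
  show ?thesis
  proof (rule idealI)
    show "subgroup (colon R J b) (add_monoid R)"
    proof (rule add.subgroupI)
      show "colon R J b \<noteq> {}"
        using assms(2) by (auto simp: colon_def intro!: exI[of _ \<zero>])
    qed (use assms(2) in \<open>auto simp: colon_def l_distr l_minus\<close>)
  next
    fix a x assume a: "a \<in> colon R J b" and x: "x \<in> carrier R"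
    hence c: "a \<in> carrier R" "a \<otimes> b \<in> J" by (auto simp: colon_def)
    hence "x \<otimes> (a \<otimes> b) \<in> J" using x J.I_l_closed by simp
    thus "x \<otimes> a \<in> colon R J b" "a \<otimes> x \<in> colon R J b"
      using x c assms(2) by (auto simp: colon_def m_ac)
  qed (rule ring_axioms)
qed

text \<open>If \<open>x \<otimes> y\<close> kills the class of \<open>b\<close> and \<open>y\<close>
  does not, then \<open>y \<otimes> b\<close> is again outside \<open>J\<close> with a colon ideal
  at least as large. Maximality makes the two equal, and \<open>x\<close> lies in the
  second.\<close>

lemma (in cring) primeideal_colon_maximal:
  assumes J: "ideal J R" and b: "b \<in> carrier R - J"
    and max: "\<And>c. c \<in> carrier R - J \<Longrightarrow> colon R J b \<subseteq> colon R J c \<Longrightarrow> colon R J c = colon R J b"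
  shows "primeideal (colon R J b) R"
proof (rule primeidealI)
  interpret J: ideal J R by fact
  show "ideal (colon R J b) R" using ideal_colon J b by blast
  show "cring R" by (rule is_cring)
  show "carrier R \<noteq> colon R J b"
  proof
    assume "carrier R = colon R J b"
    hence "\<one> \<in> colon R J b" by auto
    thus False using b by (simp add: colon_def)
  qed
  fix x y assume x: "x \<in> carrier R" and y: "y \<in> carrier R" and xy: "x \<otimes> y \<in> colon R J b"
  show "x \<in> colon R J b \<or> y \<in> colon R J b"
  proof (cases "y \<otimes> b \<in> J")
    case False
    have "colon R J b \<subseteq> colon R J (y \<otimes> b)"
    proof
      fix a assume "a \<in> colon R J b"
      hence "a \<in> carrier R" "y \<otimes> (a \<otimes> b) \<in> J"
        using J.I_l_closed y by (auto simp: colon_def)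
      thus "a \<in> colon R J (y \<otimes> b)" using m_lcomm[of y a b] b y by (simp add: colon_def)
    qed
    with max[of "y \<otimes> b"] False b y have "colon R J (y \<otimes> b) = colon R J b" by auto
    moreover have "x \<in> colon R J (y \<otimes> b)"
      using xy x y b by (simp add: colon_def m_assoc)
    ultimately show ?thesis by simp
  qed (use y in \<open>simp add: colon_def\<close>)
qed

text \<open>Let \<open>x\<close> avoid all primes but one, \<open>P\<close>. Incomparability gives
  \<open>y\<close> in \<open>I\<close> that lies in all the others and not in \<open>P\<close>; then
  \<open>x\<close> or \<open>x \<oplus> y\<close> avoids every prime.\<close>

lemma (in cring) prime_avoidance_incomparable:
  assumes "finite \<P>" and "ideal I R"
    and "\<And>P. P \<in> \<P> \<Longrightarrow> primeideal P R"
    and "\<And>P. P \<in> \<P> \<Longrightarrow> \<not> I \<subseteq> P"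
    and "\<And>P Q. P \<in> \<P> \<Longrightarrow> Q \<in> \<P> \<Longrightarrow> Q \<subseteq> P \<Longrightarrow> Q = P"
  shows "\<exists>x\<in>I. \<forall>P\<in>\<P>. x \<notin> P"
  using assms(1,3-)
proof (induction \<P> rule: finite_induct)
  case empty
  interpret ideal I R by fact
  show ?case using zero_closed by blast
next
  case (insert P \<P>)
  interpret I: ideal I R by fact
  interpret P: primeideal P R using insert.prems by simp
  obtain x where x: "x \<in> I" "\<And>Q. Q \<in> \<P> \<Longrightarrow> x \<notin> Q"
    using insert.IH insert.prems by (metis insertCI)
  \<comment> \<open>The element is a product: one factor from \<open>I\<close> outside
    \<open>P\<close>, and for each other prime \<open>Q\<close> a factor from \<open>Q\<close>
    outside \<open>P\<close>.\<close>
  have "\<exists>y\<in>I. y \<notin> P \<and> (\<forall>Q\<in>\<Q>. y \<in> Q)" if "\<Q> \<subseteq> \<P>" for \<Q>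
    using finite_subset[OF that insert.hyps(1)] that
  proof (induction \<Q> rule: finite_induct)
    case empty
    show ?case using insert.prems(2)[of P] by auto
  next
    case (insert Q \<Q>)
    then obtain y where y: "y \<in> I" "y \<notin> P" "\<forall>Q\<in>\<Q>. y \<in> Q" by auto
    have Q: "Q \<in> \<P>" "Q \<noteq> P" using insert \<open>P \<notin> \<P>\<close> by auto
    interpret Q: primeideal Q R using Q insert.prems(1) \<open>\<And>P'. P' \<in> insert P \<P> \<Longrightarrow> primeideal P' R\<close> by simp
    have "\<not> Q \<subseteq> P" using Q \<open>\<And>P' Q. P' \<in> insert P \<P> \<Longrightarrow> Q \<in> insert P \<P> \<Longrightarrow> Q \<subseteq> P' \<Longrightarrow> Q = P'\<close> by auto
    then obtain z where z: "z \<in> Q" "z \<notin> P" by auto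
    have c: "y \<in> carrier R" "z \<in> carrier R" using y z by auto
    have "y \<otimes> z \<notin> P" using P.I_prime c y z by blast
    moreover have "y \<otimes> z \<in> I" "y \<otimes> z \<in> Q"
      using I.I_r_closed Q.I_l_closed y z c by auto
    moreover have "y \<otimes> z \<in> Q'" if "Q' \<in> \<Q>" for Q'
    proof -
      have "primeideal Q' R" using that insert.prems \<open>\<And>P'. P' \<in> insert P \<P> \<Longrightarrow> primeideal P' R\<close> by auto
      then interpret Q': primeideal Q' R .
      show ?thesis using Q'.I_r_closed y that c by auto
    qed
    ultimately show ?case by (intro bexI[of _ "y \<otimes> z"]) auto
  qed
  then obtain y where y: "y \<in> I" "y \<notin> P" "\<And>Q. Q \<in> \<P> \<Longrightarrow> y \<in> Q" by blast
  show ?case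
  proof (cases "x \<in> P")
    case False
    thus ?thesis using x by (intro bexI[of _ x]) auto
  next
    case True
    have c: "x \<in> carrier R" "y \<in> carrier R" using x y by auto
    have "x \<oplus> y \<notin> P"
    proof
      assume "x \<oplus> y \<in> P"
      hence "\<ominus> x \<oplus> (x \<oplus> y) \<in> P" using True by blast
      thus False using c y by (simp add: a_assoc[symmetric] l_neg)
    qed
    moreover have "x \<oplus> y \<notin> Q" if Q: "Q \<in> \<P>" for Q
    proof
      interpret Q: primeideal Q R using insert.prems Q by simp
      assume "x \<oplus> y \<in> Q"
      hence "(x \<oplus> y) \<oplus> \<ominus> y \<in> Q" using y Q by blast
      thus False using c x Q by (simp add: a_assoc r_neg)
    qed
    ultimately show ?thesis using x y by (intro bexI[of _ "x \<oplus> y"]) auto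
  qed
qed

text \<open>Maximality within the colon ideals above that of \<open>y\<close> is maximality among
  all of them, since whatever contains \<open>colon R J b\<close> also contains
  \<open>colon R J y\<close>.\<close>

lemma (in cring) ex_colon_maximal:
  assumes "noetherian_ring R" "ideal J R" "y \<in> carrier R - J"
  shows "\<exists>b\<in>carrier R - J. colon R J y \<subseteq> colon R J b \<and>
    (\<forall>c\<in>carrier R - J. colon R J b \<subseteq> colon R J c \<longrightarrow> colon R J c = colon R J b)"
proof -
  interpret noetherian_ring R by fact
  let ?S = "{colon R J b |b. b \<in> carrier R - J \<and> colon R J y \<subseteq> colon R J b}"
  have "?S \<noteq> {}" using assms(3) by auto
  moreover have "ideal K R" if "K \<in> ?S" for K using that ideal_colon assms(2) by auto
  ultimately obtain K where K: "K \<in> ?S" "\<forall>L\<in>?S. K \<subseteq> L \<longrightarrow> L = K"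
    using ex_maximal_ideal by meson
  from K(1) obtain b where b: "b \<in> carrier R - J" "colon R J y \<subseteq> colon R J b" "K = colon R J b" by blast
  show ?thesis
  proof (intro bexI conjI ballI impI)
    fix c assume "c \<in> carrier R - J" "colon R J b \<subseteq> colon R J c"
    thus "colon R J c = colon R J b" using K(2) b by blast
  qed (use b in auto)
qed

text \<open>The argument is that for associated primes of \<open>R/J\<close>, restricted to the maximal ones:
  they are finitely many because the elements they annihilate generate a finitely generated ideal.\<close>

lemma (in cring) ex_regular_or_associated_prime:
  assumes "noetherian_ring R" "ideal J R" "ideal I R"
  shows "(\<exists>x\<in>I. colon R J x = J) \<or>
    (\<exists>b\<in>carrier R - J. primeideal (colon R J b) R \<and> I \<subseteq> colon R J b)"
proof -
  interpret noetherian_ring R by fact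
  interpret J: ideal J R by fact
  define S where "S = {b \<in> carrier R - J. \<forall>c\<in>carrier R - J.
     colon R J b \<subseteq> colon R J c \<longrightarrow> colon R J c = colon R J b}"
  have prime: "primeideal (colon R J b) R" if "b \<in> S" for b
    using that primeideal_colon_maximal[OF assms(2), of b] by (auto simp: S_def)
  \<comment> \<open>A maximal member \<open>K\<close> of this family contains all of
    \<open>S\<close>: adjoining one more element of \<open>S\<close> to its finite set
    \<open>F\<close> cannot enlarge it.\<close>
  let ?\<G> = "{Idl (J \<union> F) |F. finite F \<and> F \<subseteq> S}"
  have "?\<G> \<noteq> {}" by blast
  moreover have "ideal K R" if "K \<in> ?\<G>" for K
  proof -
    from that obtain F where "K = Idl (J \<union> F)" "F \<subseteq> S" by blast
    thus ?thesis using genideal_ideal[of "J \<union> F"] J.a_subset by (auto simp: S_def)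
  qed
  ultimately obtain K where K: "K \<in> ?\<G>" "\<forall>L\<in>?\<G>. K \<subseteq> L \<longrightarrow> L = K"
    using ex_maximal_ideal by meson
  then obtain F where F: "finite F" "F \<subseteq> S" "K = Idl (J \<union> F)" by auto
  have FJ: "J \<union> F \<subseteq> carrier R" using F J.a_subset by (auto simp: S_def)
  have finite_primes: "\<exists>c\<in>F. colon R J c = colon R J b" if b: "b \<in> S" for b
  proof -
    have bF: "J \<union> insert b F \<subseteq> carrier R" using FJ b by (auto simp: S_def)
    have "K \<subseteq> Idl (J \<union> insert b F)"
      unfolding F(3) by (rule subset_Idl_subset[OF bF]) auto
    with K(2) F b have "K = Idl (J \<union> insert b F)" by blast
    hence bK: "b \<in> K" using genideal_self[OF bF] by auto
    note P = prime[OF b]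
    \<comment> \<open>What kills every element of \<open>F\<close> modulo \<open>J\<close> kills all
      of \<open>K\<close>, in particular \<open>b\<close>. So the intersection of the colon ideals
      of \<open>F\<close> lies in that of \<open>b\<close>.\<close>
    have *: "y \<in> colon R J b" if y: "y \<in> carrier R" "\<And>c. c \<in> F \<Longrightarrow> y \<in> colon R J c" for y
    proof -
      have "J \<union> F \<subseteq> colon R J y"
      proof
        fix c assume c: "c \<in> J \<union> F"
        hence cR: "c \<in> carrier R" using FJ by blast
        have "y \<otimes> c \<in> J"
        proof (cases "c \<in> J")
          case True
          thus ?thesis using J.I_l_closed y(1) by blast
        next
          case False
          thus ?thesis using y(2)[of c] c by (simp add: colon_def)
        qed
        thus "c \<in> colon R J y" using cR m_comm[OF y(1) cR] by (simp add: colon_def)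
      qed
      hence "K \<subseteq> colon R J y"
        unfolding F(3) by (rule genideal_minimal[OF ideal_colon[OF assms(2) y(1)]])
      hence "b \<otimes> y \<in> J" using bK by (auto simp: colon_def)
      thus ?thesis using m_comm[of y b] y b by (simp add: colon_def S_def)
    qed
    \<comment> \<open>Otherwise each colon ideal of \<open>F\<close> has an element outside the
      prime of \<open>b\<close>. The product of these lies in all of them and outside that prime,
      against the preceding step. The inclusion found here is an equality by maximality of
      \<open>c\<close>.\<close>
    have "\<exists>c\<in>F. colon R J c \<subseteq> colon R J b"
    proof (rule ccontr)
      assume no: "\<not> ?thesis"
      have "\<exists>y\<in>carrier R. y \<notin> colon R J b \<and> (\<forall>c\<in>G. y \<in> colon R J c)" if "G \<subseteq> F" for G
        using finite_subset[OF that F(1)] that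
      proof (induction G rule: finite_induct)
        case empty
        show ?case using primeideal.I_notcarr[OF P] by (auto simp: colon_def)
      next
        case (insert c G)
        then obtain y where y: "y \<in> carrier R" "y \<notin> colon R J b" "\<forall>c\<in>G. y \<in> colon R J c" by auto
        obtain z where z: "z \<in> colon R J c" "z \<notin> colon R J b"
          using no insert.prems by auto
        hence zc: "z \<in> carrier R" by (simp add: colon_def)
        have c: "ideal (colon R J c') R" if "c' \<in> F" for c'
          using ideal_colon[OF assms(2)] that FJ by auto
        have "y \<otimes> z \<notin> colon R J b" using primeideal.I_prime[OF P] y z zc by blast
        moreover have "y \<otimes> z \<in> colon R J c'" if "c' \<in> insert c G" for c'
          using that ideal.I_l_closed[OF c, of c z y] ideal.I_r_closed[OF c, of c' y z] insert.prems y z zc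
          by auto
        ultimately show ?case using y zc by (intro bexI[of _ "y \<otimes> z"]) auto
      qed
      from this[of F] * show False by blast
    qed
    thus ?thesis using F b by (auto simp: S_def)
  qed
  show ?thesis
  proof (cases "\<exists>c\<in>F. I \<subseteq> colon R J c")
    case True
    thus ?thesis using prime F by (auto simp: S_def)
  next
    case False
    have "\<exists>x\<in>I. \<forall>P\<in>colon R J ` F. x \<notin> P"
    proof (rule prime_avoidance_incomparable[OF _ assms(3)])
      fix P Q assume "P \<in> colon R J ` F" "Q \<in> colon R J ` F" "Q \<subseteq> P"
      then obtain c d where "c \<in> S" "d \<in> S" "P = colon R J c" "Q = colon R J d" "colon R J d \<subseteq> colon R J c"
        using F(2) by blast
      thus "Q = P" unfolding S_def by blast
    qed (use F False prime in auto)
    then obtain x where x: "x \<in> I" "\<forall>c\<in>F. x \<notin> colon R J c" by auto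
    interpret I: ideal I R by fact
    have xc: "x \<in> carrier R" using x by auto
    \<comment> \<open>If \<open>x\<close> kills \<open>y\<close> modulo \<open>J\<close> with
      \<open>y\<close> outside \<open>J\<close>, then \<open>x\<close> lies in some maximal colon
      ideal, hence in that of an element of \<open>F\<close>, which the choice of \<open>x\<close>
      excludes.\<close>
    have "colon R J x \<subseteq> J"
    proof
      fix y assume y: "y \<in> colon R J x"
      show "y \<in> J"
      proof (rule ccontr)
        assume "y \<notin> J"
        then obtain b where b: "b \<in> S" "colon R J y \<subseteq> colon R J b"
          using ex_colon_maximal[OF assms(1,2), of y] y by (auto simp: S_def colon_def)
        then obtain c where "c \<in> F" "colon R J y \<subseteq> colon R J c" using finite_primes by metis
        moreover have "x \<in> colon R J y" using y xc m_comm[of x y] by (simp add: colon_def)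
        ultimately show False using x by blast
      qed
    qed
    moreover have "J \<subseteq> colon R J x" using xc J.I_r_closed by (auto simp: colon_def)
    ultimately show ?thesis using x by blast
  qed
qed

section \<open>Finitely supported functions and linear combinations\<close>

definition (in cring) finsupp :: "('x \<Rightarrow> 'a) set" where
  "finsupp = {f. (\<forall>x. f x \<in> carrier R) \<and> finite {x. f x \<noteq> \<zero>}}"

text \<open>The value at \<open>f\<close> of the linear functional whose values on the basis are
  \<phi>. Only \<open>f\<close> has finite support; \<phi> is arbitrary, as a cochain on a free
  module of infinite rank has to be.\<close>

definition (in cring) dot :: "('x \<Rightarrow> 'a) \<Rightarrow> ('x \<Rightarrow> 'a) \<Rightarrow> 'a" where
  "dot f \<phi> = (\<Oplus>x\<in>{x. f x \<noteq> \<zero>}. f x \<otimes> \<phi> x)"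

definition (in cring) single :: "'x \<Rightarrow> 'a \<Rightarrow> 'x \<Rightarrow> 'a" where
  "single e a = (\<lambda>x. if x = e then a else \<zero>)"

text \<open>The image of \<open>f\<close> under the linear map that sends the basis element
  \<open>e\<close> to \<open>\<tau> e\<close>, computed coordinate by coordinate.\<close>

definition (in cring) lin :: "('x \<Rightarrow> 'a) \<Rightarrow> ('x \<Rightarrow> 'y \<Rightarrow> 'a) \<Rightarrow> 'y \<Rightarrow> 'a" where
  "lin f \<tau> = (\<lambda>y. dot f (\<lambda>e. \<tau> e y))"

context cring
begin

lemma finsupp_closed: "f \<in> finsupp \<Longrightarrow> f x \<in> carrier R"
  by (simp add: finsupp_def)

lemma finsupp_finite: "f \<in> finsupp \<Longrightarrow> finite {x. f x \<noteq> \<zero>}"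
  by (simp add: finsupp_def)

lemma finsuppI:
  assumes "\<And>x. f x \<in> carrier R" "finite S" "\<And>x. x \<notin> S \<Longrightarrow> f x = \<zero>"
  shows "f \<in> finsupp"
  unfolding finsupp_def using assms by (auto intro: finite_subset[OF _ assms(2)])

lemma finsupp_zero: "(\<lambda>_. \<zero>) \<in> finsupp"
  by (simp add: finsupp_def)

lemma finsupp_add: 
  assumes "f \<in> finsupp" "g \<in> finsupp"
  shows "(\<lambda>x. f x \<oplus> g x) \<in> finsupp"
  using assms
  by (intro finsuppI[of _ "{x. f x \<noteq> \<zero>} \<union> {x. g x \<noteq> \<zero>}"]) (auto simp: finsupp_def)

lemma finsupp_smult:
  assumes "f \<in> finsupp" "a \<in> carrier R"
  shows "(\<lambda>x. a \<otimes> f x) \<in> finsupp"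
  using assms by (intro finsuppI[of _ "{x. f x \<noteq> \<zero>}"]) (auto simp: finsupp_def)

lemma finsupp_uminus:
  assumes "f \<in> finsupp"
  shows "(\<lambda>x. \<ominus> f x) \<in> finsupp"
  using assms by (intro finsuppI[of _ "{x. f x \<noteq> \<zero>}"]) (auto simp: finsupp_def)

lemma finsupp_single: "a \<in> carrier R \<Longrightarrow> single e a \<in> finsupp"
  by (intro finsuppI[of _ "{e}"]) (auto simp: single_def)

lemma dot_superset:
  assumes "f \<in> finsupp" "\<phi> \<in> UNIV \<rightarrow> carrier R" "finite S" "{x. f x \<noteq> \<zero>} \<subseteq> S"
  shows "dot f \<phi> = (\<Oplus>x\<in>S. f x \<otimes> \<phi> x)"
  unfolding dot_def using assms
  by (intro add.finprod_mono_neutral_cong_left) (auto simp: finsupp_def Pi_iff)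

lemma dot_closed:
  assumes "f \<in> finsupp" "\<phi> \<in> UNIV \<rightarrow> carrier R"
  shows "dot f \<phi> \<in> carrier R"
  unfolding dot_def using assms
  by (intro finsum_closed) (auto simp: finsupp_def Pi_iff)

lemma dot_zero: "dot (\<lambda>_. \<zero>) \<phi> = \<zero>"
  by (simp add: dot_def)

lemma dot_cong:
  assumes "f \<in> finsupp" "\<psi> \<in> UNIV \<rightarrow> carrier R" "\<And>x. f x \<noteq> \<zero> \<Longrightarrow> \<phi> x = \<psi> x"
  shows "dot f \<phi> = dot f \<psi>"
  unfolding dot_def using assms
  by (intro finsum_cong') (auto simp: finsupp_def Pi_iff)

lemma dot_add_left:
  assumes "f \<in> finsupp" "g \<in> finsupp" "\<phi> \<in> UNIV \<rightarrow> carrier R"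
  shows "dot (\<lambda>x. f x \<oplus> g x) \<phi> = dot f \<phi> \<oplus> dot g \<phi>"
proof -
  let ?S = "{x. f x \<noteq> \<zero>} \<union> {x. g x \<noteq> \<zero>}"
  have S: "finite ?S" using assms by (simp add: finsupp_def)
  have "dot (\<lambda>x. f x \<oplus> g x) \<phi> = (\<Oplus>x\<in>?S. (f x \<oplus> g x) \<otimes> \<phi> x)"
    by (rule dot_superset[OF finsupp_add[OF assms(1,2)] assms(3) S]) auto
  also have "\<dots> = (\<Oplus>x\<in>?S. f x \<otimes> \<phi> x \<oplus> g x \<otimes> \<phi> x)"
    using assms by (intro finsum_cong') (auto simp: finsupp_def Pi_iff l_distr)
  also have "\<dots> = (\<Oplus>x\<in>?S. f x \<otimes> \<phi> x) \<oplus> (\<Oplus>x\<in>?S. g x \<otimes> \<phi> x)"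
    using assms by (intro finsum_addf) (auto simp: finsupp_def Pi_iff)
  finally show ?thesis using assms S by (simp add: dot_superset[where S = ?S])
qed

lemma dot_smult_left:
  assumes "f \<in> finsupp" "\<phi> \<in> UNIV \<rightarrow> carrier R" "a \<in> carrier R"
  shows "dot (\<lambda>x. a \<otimes> f x) \<phi> = a \<otimes> dot f \<phi>"
proof -
  let ?S = "{x. f x \<noteq> \<zero>}"
  have S: "finite ?S" using assms by (simp add: finsupp_def)
  have "dot (\<lambda>x. a \<otimes> f x) \<phi> = (\<Oplus>x\<in>?S. (a \<otimes> f x) \<otimes> \<phi> x)"
    using assms(3) by (intro dot_superset[OF finsupp_smult[OF assms(1,3)] assms(2) S]) auto
  also have "\<dots> = (\<Oplus>x\<in>?S. a \<otimes> (f x \<otimes> \<phi> x))"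
    using assms by (intro finsum_cong') (auto simp: finsupp_def Pi_iff m_assoc)
  also have "\<dots> = a \<otimes> (\<Oplus>x\<in>?S. f x \<otimes> \<phi> x)"
    using assms S by (intro finsum_rdistr[symmetric]) (auto simp: finsupp_def Pi_iff)
  finally show ?thesis by (simp add: dot_def)
qed

lemma dot_uminus_left:
  assumes "f \<in> finsupp" "\<phi> \<in> UNIV \<rightarrow> carrier R"
  shows "dot (\<lambda>x. \<ominus> f x) \<phi> = \<ominus> dot f \<phi>"
proof -
  have "(\<lambda>x. \<ominus> f x) = (\<lambda>x. \<ominus> \<one> \<otimes> f x)"
    using assms by (auto simp: finsupp_def l_minus)
  thus ?thesis using dot_smult_left[OF assms, of "\<ominus> \<one>"] dot_closed[OF assms] by (simp add: l_minus)
qed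

lemma dot_add_right:
  assumes "f \<in> finsupp" "\<phi> \<in> UNIV \<rightarrow> carrier R" "\<psi> \<in> UNIV \<rightarrow> carrier R"
  shows "dot f (\<lambda>x. \<phi> x \<oplus> \<psi> x) = dot f \<phi> \<oplus> dot f \<psi>"
proof -
  have "dot f (\<lambda>x. \<phi> x \<oplus> \<psi> x) = (\<Oplus>x\<in>{x. f x \<noteq> \<zero>}. f x \<otimes> \<phi> x \<oplus> f x \<otimes> \<psi> x)"
    unfolding dot_def using assms
    by (intro finsum_cong') (auto simp: finsupp_def Pi_iff r_distr)
  also have "\<dots> = dot f \<phi> \<oplus> dot f \<psi>"
    unfolding dot_def using assms by (intro finsum_addf) (auto simp: finsupp_def Pi_iff)
  finally show ?thesis .
qed

lemma dot_smult_right: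
  assumes "f \<in> finsupp" "\<phi> \<in> UNIV \<rightarrow> carrier R" "a \<in> carrier R"
  shows "dot f (\<lambda>x. a \<otimes> \<phi> x) = a \<otimes> dot f \<phi>"
proof -
  have "dot f (\<lambda>x. a \<otimes> \<phi> x) = (\<Oplus>x\<in>{x. f x \<noteq> \<zero>}. a \<otimes> (f x \<otimes> \<phi> x))"
    unfolding dot_def using assms
    by (intro finsum_cong') (auto simp: finsupp_def Pi_iff m_lcomm)
  also have "\<dots> = a \<otimes> dot f \<phi>"
    unfolding dot_def using assms 
    by (intro finsum_rdistr[symmetric]) (auto simp: finsupp_def Pi_iff)
  finally show ?thesis .
qed

lemma dot_uminus_right:
  assumes "f \<in> finsupp" "\<phi> \<in> UNIV \<rightarrow> carrier R"
  shows "dot f (\<lambda>x. \<ominus> \<phi> x) = \<ominus> dot f \<phi>"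
proof -
  have "(\<lambda>x. \<ominus> \<phi> x) = (\<lambda>x. \<ominus> \<one> \<otimes> \<phi> x)"
    using assms by (auto simp: Pi_iff l_minus)
  thus ?thesis using dot_smult_right[OF assms, of "\<ominus> \<one>"] dot_closed[OF assms] by (simp add: l_minus)
qed

lemma dot_single_left:
  assumes "a \<in> carrier R" "\<phi> \<in> UNIV \<rightarrow> carrier R"
  shows "dot (single e a) \<phi> = a \<otimes> \<phi> e"
proof -
  have "dot (single e a) \<phi> = (\<Oplus>x\<in>{e}. single e a x \<otimes> \<phi> x)"
    by (rule dot_superset[OF finsupp_single[OF assms(1)] assms(2)]) (auto simp: single_def)
  also have "\<dots> = a \<otimes> \<phi> e"
    using assms by (subst finsum_insert) (auto simp: single_def Pi_iff)
  finally show ?thesis .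
qed

lemma dot_delta_right:
  assumes "f \<in> finsupp" "a \<in> carrier R"
  shows "dot f (\<lambda>e. single e a y) = f y \<otimes> a"
proof -
  let ?S = "insert y {x. f x \<noteq> \<zero>}"
  have "dot f (\<lambda>e. single e a y) = (\<Oplus>x\<in>?S. f x \<otimes> single x a y)"
    using assms by (intro dot_superset) (auto simp: single_def finsupp_def)
  also have "\<dots> = (\<Oplus>x\<in>{y}. f x \<otimes> a)"
    using assms 
    by (intro add.finprod_mono_neutral_cong_right) (auto simp: single_def finsupp_def)
  also have "\<dots> = f y \<otimes> a"
    using assms by (subst finsum_insert) (auto simp: finsupp_def)
  finally show ?thesis .
qed

lemma ideal_finsum:
  assumes "ideal J R" "finite S" "\<And>x. x \<in> S \<Longrightarrow> g x \<in> J"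
  shows "(\<Oplus>x\<in>S. g x) \<in> J"
proof -
  interpret J: ideal J R by fact
  show ?thesis using assms(2,3)
  proof (induction S rule: finite_induct)
    case (insert x S)
    hence "(\<Oplus>x\<in>insert x S. g x) = g x \<oplus> (\<Oplus>x\<in>S. g x)"
      using J.a_subset by (intro finsum_insert) auto
    thus ?case using insert by simp
  qed simp
qed

lemma dot_in_ideal:
  assumes "ideal J R" "f \<in> finsupp" "\<And>x. f x \<noteq> \<zero> \<Longrightarrow> \<phi> x \<in> J"
  shows "dot f \<phi> \<in> J"
  unfolding dot_def using assms
  by (intro ideal_finsum) (auto simp: finsupp_def intro: ideal.I_l_closed)

text \<open>Both claims share one induction, because additivity of \<open>dot\<close> at each step
  requires the partial sum to be finitely supported.\<close>

lemma finsum_combination: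
  assumes "finite S" "\<And>x. x \<in> S \<Longrightarrow> c x \<in> carrier R" "\<And>x. x \<in> S \<Longrightarrow> \<tau> x \<in> finsupp"
  shows finsupp_finsum: "(\<lambda>y. \<Oplus>x\<in>S. c x \<otimes> \<tau> x y) \<in> finsupp" 
    and dot_finsum: "\<psi> \<in> UNIV \<rightarrow> carrier R \<Longrightarrow>
      dot (\<lambda>y. \<Oplus>x\<in>S. c x \<otimes> \<tau> x y) \<psi> = (\<Oplus>x\<in>S. c x \<otimes> dot (\<tau> x) \<psi>)"
proof -
  have "(\<lambda>y. \<Oplus>x\<in>S. c x \<otimes> \<tau> x y) \<in> finsupp \<and> (\<psi> \<in> UNIV \<rightarrow> carrier R \<longrightarrow>
      dot (\<lambda>y. \<Oplus>x\<in>S. c x \<otimes> \<tau> x y) \<psi> = (\<Oplus>x\<in>S. c x \<otimes> dot (\<tau> x) \<psi>))"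
    using assms
  proof (induction S rule: finite_induct)
    case empty
    show ?case by (simp add: finsupp_zero dot_zero)
  next
    case (insert s S)
    have eq: "(\<lambda>y. \<Oplus>x\<in>insert s S. c x \<otimes> \<tau> x y)
        = (\<lambda>y. c s \<otimes> \<tau> s y \<oplus> (\<Oplus>x\<in>S. c x \<otimes> \<tau> x y))"
      using insert.prems insert.hyps
      by (intro ext finsum_insert) (auto simp: finsupp_closed)
    have f: "(\<lambda>y. c s \<otimes> \<tau> s y) \<in> finsupp" using insert.prems by (simp add: finsupp_smult)
    have IH: "(\<lambda>y. \<Oplus>x\<in>S. c x \<otimes> \<tau> x y) \<in> finsupp" using insert by simp
    show ?case
    proof (intro conjI impI)
      show "(\<lambda>y. \<Oplus>x\<in>insert s S. c x \<otimes> \<tau> x y) \<in> finsupp"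
        unfolding eq by (rule finsupp_add[OF f IH])
      assume \<psi>: "\<psi> \<in> UNIV \<rightarrow> carrier R"
      have "(\<Oplus>x\<in>insert s S. c x \<otimes> dot (\<tau> x) \<psi>)
          = c s \<otimes> dot (\<tau> s) \<psi> \<oplus> (\<Oplus>x\<in>S. c x \<otimes> dot (\<tau> x) \<psi>)"
        using insert \<psi> by (intro finsum_insert) (auto simp: dot_closed)
      thus "dot (\<lambda>y. \<Oplus>x\<in>insert s S. c x \<otimes> \<tau> x y) \<psi> = (\<Oplus>x\<in>insert s S. c x \<otimes> dot (\<tau> x) \<psi>)"
        unfolding eq using \<psi> insert by (simp add: dot_add_left[OF f IH] dot_smult_left)
    qed
  qed
  thus "(\<lambda>y. \<Oplus>x\<in>S. c x \<otimes> \<tau> x y) \<in> finsupp" 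
    "\<psi> \<in> UNIV \<rightarrow> carrier R \<Longrightarrow>
      dot (\<lambda>y. \<Oplus>x\<in>S. c x \<otimes> \<tau> x y) \<psi> = (\<Oplus>x\<in>S. c x \<otimes> dot (\<tau> x) \<psi>)" by auto
qed

lemma finsupp_lin:
  assumes "f \<in> finsupp" "\<tau> \<in> UNIV \<rightarrow> finsupp"
  shows "lin f \<tau> \<in> finsupp"
  unfolding lin_def dot_def using assms
  by (intro finsupp_finsum) (auto simp: finsupp_closed finsupp_finite Pi_iff)

text \<open>A functional pulled back along a linear map is again given by its values on the basis.
  This is the rule that moves the differential from chains to cochains.\<close>

lemma dot_lin:
  assumes "f \<in> finsupp" "\<tau> \<in> UNIV \<rightarrow> finsupp" "\<psi> \<in> UNIV \<rightarrow> carrier R"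
  shows "dot (lin f \<tau>) \<psi> = dot f (\<lambda>e. dot (\<tau> e) \<psi>)"
  unfolding lin_def dot_def[of f] using assms
  by (intro dot_finsum) (auto simp: finsupp_closed finsupp_finite Pi_iff)

lemma lin_single:
  assumes "f \<in> finsupp" "a \<in> carrier R"
  shows "lin f (\<lambda>e. single e a) = (\<lambda>y. f y \<otimes> a)"
  using dot_delta_right[OF assms] by (simp add: lin_def)

lemma lin_lin:
  assumes "f \<in> finsupp" "\<sigma> \<in> UNIV \<rightarrow> finsupp" "\<tau> \<in> UNIV \<rightarrow> finsupp"
  shows "lin (lin f \<sigma>) \<tau> = lin f (\<lambda>e. lin (\<sigma> e) \<tau>)"
proof
  fix y
  have "(\<lambda>e. \<tau> e y) \<in> UNIV \<rightarrow> carrier R" using assms(3) by (auto simp: Pi_iff finsupp_closed)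
  from dot_lin[OF assms(1,2) this] show "lin (lin f \<sigma>) \<tau> y = lin f (\<lambda>e. lin (\<sigma> e) \<tau>) y"
    unfolding lin_def[of _ \<tau>] lin_def[of f "\<lambda>e. _ e"] by simp
qed

lemma carrier_free_module: "carrier (free_module R UNIV) = finsupp"
  by (auto simp: free_module_def finsupp_def)

lemma carrier_free_module_on:
  "carrier (free_module R B) = {f \<in> finsupp. \<forall>x. f x \<noteq> \<zero> \<longrightarrow> x \<in> B}"
  by (auto simp: free_module_def finsupp_def)

lemma module_free_module: "module R (free_module R B)"
proof (rule moduleI)
  show "abelian_group (free_module R B)"
  proof (rule abelian_groupI)
    fix f assume f: "f \<in> carrier (free_module R B)"
    show "\<exists>g\<in>carrier (free_module R B). g \<oplus>\<^bsub>free_module R B\<^esub> f = \<zero>\<^bsub>free_module R B\<^esub>"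
      using f unfolding carrier_free_module_on
      by (intro bexI[of _ "\<lambda>x. \<ominus> f x"]) (auto simp: free_module_def finsupp_closed l_neg finsupp_uminus)
  next
    fix f g assume "f \<in> carrier (free_module R B)" "g \<in> carrier (free_module R B)"
    thus "f \<oplus>\<^bsub>free_module R B\<^esub> g \<in> carrier (free_module R B)"
      unfolding carrier_free_module_on
      by (auto simp: free_module_def finsupp_add) (metis l_zero zero_closed)
  qed (auto simp: carrier_free_module_on free_module_def finsupp_closed finsupp_zero a_ac)
next
  fix a f assume "a \<in> carrier R" "f \<in> carrier (free_module R B)"
  thus "a \<odot>\<^bsub>free_module R B\<^esub> f \<in> carrier (free_module R B)"
    unfolding carrier_free_module_on by (auto simp: free_module_def finsupp_smult) (metis r_null)
qed (auto simp: free_module_def l_distr r_distr m_assoc is_cring)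

lemma finsum_free_module:
  assumes "finite S" "\<And>k. k \<in> S \<Longrightarrow> g k \<in> finsupp"
  shows "(\<Oplus>\<^bsub>free_module R UNIV\<^esub>k\<in>S. g k) = (\<lambda>y. \<Oplus>k\<in>S. g k y)"
proof -
  interpret F: module R "free_module R UNIV" by (rule module_free_module)
  show ?thesis using assms
  proof (induction S rule: finite_induct)
    case empty
    show ?case unfolding F.finsum_empty by (simp add: free_module_def)
  next
    case (insert s S)
    have "(\<Oplus>\<^bsub>free_module R UNIV\<^esub>k\<in>insert s S. g k)
        = g s \<oplus>\<^bsub>free_module R UNIV\<^esub> (\<Oplus>\<^bsub>free_module R UNIV\<^esub>k\<in>S. g k)"
      using insert by (intro F.finsum_insert) (auto simp: carrier_free_module)
    moreover have "(\<Oplus>k\<in>insert s S. g k y) = g s y \<oplus> (\<Oplus>k\<in>S. g k y)" for y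
      using insert by (intro finsum_insert) (auto simp: finsupp_closed)
    ultimately show ?case using insert by (simp add: free_module_def)
  qed
qed

end

section \<open>Syzygies and cocycles\<close>

text \<open>With \<open>unlab\<close> inverting \<open>rel_label\<close>, the differential of the resolution is
  \<open>f \<mapsto> lin f unlab\<close>, and that of the dual complex is \<open>\<psi> \<mapsto> (\<lambda>l. dot (unlab l) \<psi>)\<close>.\<close>

definition (in cring) unlab :: "('a, 'm) label \<Rightarrow> ('a, 'm) label \<Rightarrow> 'a" where
  "unlab l = (if l \<in> rel_label R ` finsupp then inv_into finsupp (rel_label R) l else (\<lambda>_. \<zero>))"

context cring
begin

text \<open>The graph over the support determines the function, and finiteness of the support is
  what makes \<open>Abs_fset\<close> faithful on such graphs.\<close>

lemma inj_on_rel_label: "inj_on (rel_label R) finsupp"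
proof (rule inj_onI)
  fix f g :: "('a, 'm) label \<Rightarrow> 'a" assume f: "f \<in> finsupp" and g: "g \<in> finsupp" and eq: "rel_label R f = rel_label R g"
  have fin: "{(x, h x) |x. h x \<noteq> \<zero>} \<in> {A. finite A}" if "h \<in> finsupp" for h :: "('a, 'm) label \<Rightarrow> 'a"
  proof -
    have "{(x, h x) |x. h x \<noteq> \<zero>} = (\<lambda>x. (x, h x)) ` {x. h x \<noteq> \<zero>}" by auto
    thus ?thesis using finsupp_finite[OF that] by simp
  qed
  have "{(x, f x) |x. f x \<noteq> \<zero>} = {(x, g x) |x. g x \<noteq> \<zero>}"
    using eq fin[OF f] fin[OF g] by (simp add: rel_label_def Abs_fset_inject)
  hence "f x \<noteq> \<zero> \<and> y = f x \<longleftrightarrow> g x \<noteq> \<zero> \<and> y = g x" for x y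
    by (auto simp: set_eq_iff)
  thus "f = g" by (metis ext)
qed

lemma unlab_rel_label [simp]: "f \<in> finsupp \<Longrightarrow> unlab (rel_label R f) = f"
  by (simp add: unlab_def inv_into_f_f[OF inj_on_rel_label])

text \<open>Labels that name no function are sent to zero, so \<open>unlab\<close> is a total family
  and can be used in \<open>lin\<close> without side conditions on the label.\<close>

lemma unlab_finsupp: "unlab l \<in> finsupp"
  by (simp add: unlab_def finsupp_zero inv_into_into)

text \<open>Injectivity of \<open>rel_label\<close> turns the sum over \<open>K\<close> into a sum
  over the support of \<open>f\<close>, so that the resulting formula no longer depends on
  \<open>K\<close>.\<close>

lemma lin_ext_free_module:
  assumes "K \<subseteq> finsupp" "f \<in> finsupp" "{x. f x \<noteq> \<zero>} \<subseteq> rel_label R ` K"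
  shows "lin_ext R (free_module R UNIV) (rel_label R) K f = lin f unlab"
proof -
  let ?S = "{k \<in> K. f (rel_label R k) \<noteq> \<zero>}"
  have inj: "inj_on (rel_label R) ?S"
    using inj_on_rel_label by (rule inj_on_subset) (use assms(1) in auto)
  have im: "rel_label R ` ?S = {x. f x \<noteq> \<zero>}" using assms(3) by auto
  have fin: "finite ?S"
    using finsupp_finite[OF assms(2)] finite_image_iff[OF inj] im by simp
  have "lin_ext R (free_module R UNIV) (rel_label R) K f
      = (\<lambda>y. \<Oplus>k\<in>?S. (f (rel_label R k) \<odot>\<^bsub>free_module R UNIV\<^esub> k) y)"
    unfolding lin_ext_def using assms
    by (intro finsum_free_module[OF fin]) (auto simp: free_module_def finsupp_smult finsupp_closed)
  also have "\<dots> = (\<lambda>y. \<Oplus>k\<in>?S. f (rel_label R k) \<otimes> k y)"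
    by (simp add: free_module_def)
  also have "\<dots> = lin f unlab"
  proof
    fix y
    have "lin f unlab y = (\<Oplus>x\<in>rel_label R ` ?S. f x \<otimes> unlab x y)"
      unfolding lin_def dot_def im ..
    also have "\<dots> = (\<Oplus>k\<in>?S. f (rel_label R k) \<otimes> unlab (rel_label R k) y)"
      using assms unlab_finsupp by (intro finsum_reindex inj) (auto simp: finsupp_closed)
    also have "\<dots> = (\<Oplus>k\<in>?S. f (rel_label R k) \<otimes> k y)"
      using assms by (intro finsum_cong') (auto simp: finsupp_closed subset_iff)
    finally show "(\<Oplus>k\<in>?S. f (rel_label R k) \<otimes> k y) = lin f unlab y" by simp
  qed
  finally show ?thesis .
qed

end

text \<open>The basis of \<open>F\<^sub>i\<close>, under one name for degree 0, where labels name
  elements of the module, and for later degrees, where they name syzygies.\<close>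

definition (in module) base :: "nat \<Rightarrow> ('a, 'c) label set" where
  "base i = (case i of 0 \<Rightarrow> Gen ` carrier M | Suc j \<Rightarrow> rel_label R ` syz R M j)"

context module
begin

lemma base_simps [simp]: "base 0 = Gen ` carrier M" "base (Suc i) = rel_label R ` syz R M i"
  by (simp_all add: base_def)

lemma res_module_base: "res_module R M i = free_module R (base i)"
  by (cases i) simp_all

section \<open>The augmentation of the resolution and the module structure of the syzygies\<close>

definition aug :: "(('a, 'c) label \<Rightarrow> 'a) \<Rightarrow> 'c" where
  "aug f = lin_ext R M Gen (carrier M) f"

lemma aug_superset:
  assumes "f \<in> finsupp" "finite S" "S \<subseteq> carrier M" "{m \<in> carrier M. f (Gen m) \<noteq> \<zero>} \<subseteq> S"
  shows "aug f = (\<Oplus>\<^bsub>M\<^esub>m\<in>S. f (Gen m) \<odot>\<^bsub>M\<^esub> m)"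
  unfolding aug_def lin_ext_def using assms
  by (intro M.add.finprod_mono_neutral_cong_left) (auto simp: finsupp_closed)

lemma finite_gens:
  assumes "f \<in> finsupp"
  shows "finite {m \<in> carrier M. f (Gen m) \<noteq> \<zero>}"
proof -
  have "finite (Gen -` {x. f x \<noteq> \<zero>})"
    using finsupp_finite[OF assms] by (rule finite_vimageI) (simp add: inj_def)
  thus ?thesis by (rule finite_subset[rotated]) auto
qed

lemma aug_add:
  assumes "f \<in> finsupp" "g \<in> finsupp"
  shows "aug (\<lambda>x. f x \<oplus> g x) = aug f \<oplus>\<^bsub>M\<^esub> aug g"
proof -
  let ?S = "{m \<in> carrier M. f (Gen m) \<noteq> \<zero>} \<union> {m \<in> carrier M. g (Gen m) \<noteq> \<zero>}"
  have S: "finite ?S" using finite_gens assms by blast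
  have "aug (\<lambda>x. f x \<oplus> g x) = (\<Oplus>\<^bsub>M\<^esub>m\<in>?S. (f (Gen m) \<oplus> g (Gen m)) \<odot>\<^bsub>M\<^esub> m)"
    by (rule aug_superset[OF finsupp_add[OF assms] S]) auto
  also have "\<dots> = (\<Oplus>\<^bsub>M\<^esub>m\<in>?S. f (Gen m) \<odot>\<^bsub>M\<^esub> m \<oplus>\<^bsub>M\<^esub> g (Gen m) \<odot>\<^bsub>M\<^esub> m)"
    using assms by (intro M.finsum_cong') (auto simp: finsupp_closed smult_l_distr)
  also have "\<dots> = (\<Oplus>\<^bsub>M\<^esub>m\<in>?S. f (Gen m) \<odot>\<^bsub>M\<^esub> m) \<oplus>\<^bsub>M\<^esub> (\<Oplus>\<^bsub>M\<^esub>m\<in>?S. g (Gen m) \<odot>\<^bsub>M\<^esub> m)"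
    using assms by (intro M.finsum_addf) (auto simp: finsupp_closed)
  also have "(\<Oplus>\<^bsub>M\<^esub>m\<in>?S. f (Gen m) \<odot>\<^bsub>M\<^esub> m) = aug f"
    by (rule aug_superset[OF assms(1) S, symmetric]) auto
  also have "(\<Oplus>\<^bsub>M\<^esub>m\<in>?S. g (Gen m) \<odot>\<^bsub>M\<^esub> m) = aug g"
    by (rule aug_superset[OF assms(2) S, symmetric]) auto
  finally show ?thesis .
qed

lemma aug_smult:
  assumes "f \<in> finsupp" "a \<in> carrier R"
  shows "aug (\<lambda>x. a \<otimes> f x) = a \<odot>\<^bsub>M\<^esub> aug f"
proof -
  let ?S = "{m \<in> carrier M. f (Gen m) \<noteq> \<zero>}"
  have S: "finite ?S" by (rule finite_gens[OF assms(1)])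
  have "aug (\<lambda>x. a \<otimes> f x) = (\<Oplus>\<^bsub>M\<^esub>m\<in>?S. (a \<otimes> f (Gen m)) \<odot>\<^bsub>M\<^esub> m)"
    using assms by (intro aug_superset[OF finsupp_smult[OF assms] S]) auto
  also have "\<dots> = (\<Oplus>\<^bsub>M\<^esub>m\<in>?S. a \<odot>\<^bsub>M\<^esub> (f (Gen m) \<odot>\<^bsub>M\<^esub> m))"
    using assms by (intro M.finsum_cong') (auto simp: finsupp_closed smult_assoc1)
  also have "\<dots> = a \<odot>\<^bsub>M\<^esub> (\<Oplus>\<^bsub>M\<^esub>m\<in>?S. f (Gen m) \<odot>\<^bsub>M\<^esub> m)"
    using assms by (intro finsum_smult_ldistr[symmetric] S) (auto simp: finsupp_closed)
  finally show ?thesis by (simp add: aug_def lin_ext_def)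
qed

lemma aug_zero: "aug (\<lambda>_. \<zero>) = \<zero>\<^bsub>M\<^esub>"
  by (simp add: aug_def lin_ext_def)

lemma aug_single:
  assumes "m \<in> carrier M" "a \<in> carrier R"
  shows "aug (single (Gen m) a) = a \<odot>\<^bsub>M\<^esub> m"
proof -
  let ?s = "single (Gen m :: ('a, 'c) label) a"
  have "aug ?s = (\<Oplus>\<^bsub>M\<^esub>x\<in>{m}. ?s (Gen x) \<odot>\<^bsub>M\<^esub> x)"
    using assms by (intro aug_superset[OF finsupp_single[OF assms(2)], where S = "{m}"]) (auto simp: single_def)
  also have "\<dots> = a \<odot>\<^bsub>M\<^esub> m"
    using assms by (subst M.finsum_insert) (auto simp: single_def)
  finally show ?thesis .
qed

lemma syz_0_iff:
  "f \<in> syz R M 0 \<longleftrightarrow> f \<in> finsupp \<and> {x. f x \<noteq> \<zero>} \<subseteq> base 0 \<and> aug f = \<zero>\<^bsub>M\<^esub>"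
  by (auto simp: carrier_free_module_on aug_def)

lemma syz_finsupp: "syz R M i \<subseteq> finsupp"
  by (cases i) (auto simp: carrier_free_module_on)

lemma syz_Suc_iff:
  "f \<in> syz R M (Suc i) \<longleftrightarrow>
     f \<in> finsupp \<and> {x. f x \<noteq> \<zero>} \<subseteq> base (Suc i) \<and> lin f unlab = (\<lambda>_. \<zero>)"
proof (cases "f \<in> finsupp \<and> {x. f x \<noteq> \<zero>} \<subseteq> base (Suc i)")
  case True
  hence "lin_ext R (free_module R UNIV) (rel_label R) (syz R M i) f = lin f unlab"
    by (intro lin_ext_free_module) (use syz_finsupp in auto)
  moreover have "f \<in> carrier (free_module R (base (Suc i)))"
    using True unfolding carrier_free_module_on by blast
  moreover have "\<zero>\<^bsub>free_module R UNIV\<^esub> = (\<lambda>_ :: ('a, 'c) label. \<zero>)" by (simp add: free_module_def)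
  ultimately show ?thesis using True by simp
qed (auto simp: carrier_free_module_on)

lemma syz_base: "f \<in> syz R M i \<Longrightarrow> f x \<noteq> \<zero> \<Longrightarrow> x \<in> base i"
  by (cases i) (auto simp only: syz_0_iff syz_Suc_iff)

declare syz.simps [simp del]

lemma res_diff_eq:
  assumes "f \<in> carrier (res_module R M (Suc i))"
  shows "res_diff R M i f = lin f unlab"
  using assms syz_finsupp unfolding res_diff_def res_module_base carrier_free_module_on
  by (intro lin_ext_free_module) auto

lemma syz_zero: "(\<lambda>_. \<zero>) \<in> syz R M i"
  by (cases i) (auto simp: syz_0_iff syz_Suc_iff finsupp_zero aug_zero lin_def dot_zero)

lemma unlab_closed: "(\<lambda>e. unlab e y) \<in> UNIV \<rightarrow> carrier R"
  by (simp add: finsupp_closed[OF unlab_finsupp])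

lemma syz_add:
  assumes "f \<in> syz R M i" "g \<in> syz R M i"
  shows "(\<lambda>x. f x \<oplus> g x) \<in> syz R M i"
proof -
  have fg: "f \<in> finsupp" "g \<in> finsupp" using assms syz_finsupp by auto
  have "{x. f x \<oplus> g x \<noteq> \<zero>} \<subseteq> base i"
  proof
    fix x assume "x \<in> {x. f x \<oplus> g x \<noteq> \<zero>}"
    hence "f x \<noteq> \<zero> \<or> g x \<noteq> \<zero>" by auto
    thus "x \<in> base i" using syz_base assms by blast
  qed
  thus ?thesis using assms fg
    by (cases i) (auto simp: syz_0_iff syz_Suc_iff finsupp_add aug_add lin_def fun_eq_iff
      dot_add_left unlab_closed simp del: base_simps)
qed

lemma syz_smult:
  assumes "f \<in> syz R M i" "a \<in> carrier R"
  shows "(\<lambda>x. a \<otimes> f x) \<in> syz R M i"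
proof -
  have f: "f \<in> finsupp" using assms syz_finsupp by auto
  have "{x. a \<otimes> f x \<noteq> \<zero>} \<subseteq> base i"
  proof
    fix x assume "x \<in> {x. a \<otimes> f x \<noteq> \<zero>}"
    hence "f x \<noteq> \<zero>" using assms(2) by auto
    thus "x \<in> base i" using syz_base assms by blast
  qed
  thus ?thesis using assms f
    by (cases i) (auto simp: syz_0_iff syz_Suc_iff finsupp_smult aug_smult lin_def fun_eq_iff
      dot_smult_left unlab_closed simp del: base_simps)
qed

lemma syz_finsum:
  assumes "finite S" "\<And>x. x \<in> S \<Longrightarrow> c x \<in> carrier R" "\<And>x. x \<in> S \<Longrightarrow> \<tau> x \<in> syz R M i"
  shows "(\<lambda>y. \<Oplus>x\<in>S. c x \<otimes> \<tau> x y) \<in> syz R M i"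
  using assms
proof (induction S rule: finite_induct)
  case empty
  show ?case by (simp add: syz_zero)
next
  case (insert s S)
  have "(\<lambda>y. \<Oplus>x\<in>insert s S. c x \<otimes> \<tau> x y) = (\<lambda>y. c s \<otimes> \<tau> s y \<oplus> (\<Oplus>x\<in>S. c x \<otimes> \<tau> x y))"
    using insert finsupp_closed[OF subsetD[OF syz_finsupp insert.prems(2)]]
    by (intro ext R.finsum_insert) auto
  thus ?case using insert by (simp add: syz_add syz_smult)
qed

lemma lin_in_syz:
  assumes "f \<in> finsupp" "\<And>x. f x \<noteq> \<zero> \<Longrightarrow> \<tau> x \<in> syz R M i"
  shows "lin f \<tau> \<in> syz R M i"
  unfolding lin_def dot_def using assms
  by (intro syz_finsum) (auto simp: finsupp_closed finsupp_finite)

text \<open>Additivity of a cocycle is read off from relations such as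
  \<open>[f] + [g] - [f + g]\<close>, which are among the next syzygies.\<close>

lemma cocycle_additive:
  assumes \<phi>: "\<phi> \<in> UNIV \<rightarrow> carrier R" "\<And>z. z \<in> syz R M (Suc i) \<Longrightarrow> dot z \<phi> = \<zero>"
    and z: "f \<in> syz R M i" "g \<in> syz R M i" and a: "a \<in> carrier R"
  shows "\<phi> (rel_label R (\<lambda>x. f x \<oplus> a \<otimes> g x)) = \<phi> (rel_label R f) \<oplus> a \<otimes> \<phi> (rel_label R g)"
proof -
  let ?h = "\<lambda>x. f x \<oplus> a \<otimes> g x"
  have h: "?h \<in> syz R M i" using z a by (simp add: syz_add syz_smult)
  have fin: "f \<in> finsupp" "g \<in> finsupp" "?h \<in> finsupp" using z h syz_finsupp by auto
  define w where "w = (\<lambda>x. single (rel_label R ?h) \<one> x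
    \<oplus> (single (rel_label R f) (\<ominus> \<one>) x \<oplus> single (rel_label R g) (\<ominus> a) x))"
  have s: "single (rel_label R ?h) \<one> \<in> finsupp" "single (rel_label R f) (\<ominus> \<one>) \<in> finsupp"
    "single (rel_label R g) (\<ominus> a) \<in> finsupp" using a by (simp_all add: finsupp_single)
  \<comment> \<open>Used for two kinds of \<psi>: the coordinates of \<open>unlab\<close> show that
    \<open>w\<close> is a relation, and then \<phi> itself gives the claimed equation.\<close>
  have dot_w: "dot w \<psi> = \<psi> (rel_label R ?h)
     \<oplus> (\<ominus> \<psi> (rel_label R f) \<oplus> \<ominus> (a \<otimes> \<psi> (rel_label R g)))" if "\<psi> \<in> UNIV \<rightarrow> carrier R" for \<psi>
    using that a unfolding w_def
    by (simp add: dot_add_left[OF s(1) finsupp_add[OF s(2,3)]] dot_add_left[OF s(2,3)]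
        dot_single_left l_minus Pi_iff)
  have "w \<in> syz R M (Suc i)"
    unfolding syz_Suc_iff
  proof (intro conjI)
    show "w \<in> finsupp" unfolding w_def using s by (simp add: finsupp_add)
    show "{x. w x \<noteq> \<zero>} \<subseteq> base (Suc i)" using z h by (auto simp: w_def single_def split: if_splits)
    show "lin w unlab = (\<lambda>_. \<zero>)"
    proof
      fix y
      have "f y \<in> carrier R" "g y \<in> carrier R" using fin by (simp_all add: finsupp_closed)
      thus "lin w unlab y = \<zero>"
        unfolding lin_def dot_w[OF unlab_closed] using fin a
        by (simp add: R.minus_add[symmetric] R.r_neg)
    qed
  qed
  hence "\<phi> (rel_label R ?h) \<oplus> (\<ominus> \<phi> (rel_label R f) \<oplus> \<ominus> (a \<otimes> \<phi> (rel_label R g))) = \<zero>"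
    using \<phi> dot_w[of \<phi>] by simp
  moreover have \<phi>c: "\<phi> l \<in> carrier R" for l using \<phi> by auto
  ultimately have "\<phi> (rel_label R ?h) \<oplus> \<ominus> (\<phi> (rel_label R f) \<oplus> a \<otimes> \<phi> (rel_label R g)) = \<zero>"
    using a by (simp add: R.minus_add)
  hence "\<phi> (rel_label R ?h) \<ominus> (\<phi> (rel_label R f) \<oplus> a \<otimes> \<phi> (rel_label R g)) = \<zero>"
    unfolding a_minus_def .
  thus ?thesis by (rule iffD1[OF R.r_right_minus_eq, rotated 2]) (use a \<phi>c in simp_all)
qed

text \<open>A cocycle of degree i + 1 induces a linear functional on the i-th syzygy module, namely
  its value at the basis element named by a syzygy. Two-term linearity extends to finite
  combinations by induction.\<close>

lemma cocycle_lin: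
  assumes \<phi>: "\<phi> \<in> UNIV \<rightarrow> carrier R" "\<And>z. z \<in> syz R M (Suc i) \<Longrightarrow> dot z \<phi> = \<zero>"
    and f: "f \<in> finsupp" and \<tau>: "\<And>e. \<tau> e \<in> syz R M i"
  shows "\<phi> (rel_label R (lin f \<tau>)) = dot f (\<lambda>e. \<phi> (rel_label R (\<tau> e)))"
proof -
  have *: "\<phi> (rel_label R (\<lambda>y. \<Oplus>x\<in>S. f x \<otimes> \<tau> x y)) = (\<Oplus>x\<in>S. f x \<otimes> \<phi> (rel_label R (\<tau> x)))"
    if "finite S" for S
    using that
  proof (induction S rule: finite_induct)
    case empty
    let ?z = "\<phi> (rel_label R (\<lambda>_. \<zero>))"
    \<comment> \<open>The zero syzygy has a basis element of its own. That the cocycle vanishes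
      there has to be derived, from writing zero as zero plus one times zero.\<close>
    have "?z = ?z \<oplus> \<one> \<otimes> ?z"
      using cocycle_additive[OF \<phi> syz_zero syz_zero one_closed] by simp
    hence "?z = \<zero>" using \<phi>(1) by (metis PiE UNIV_I R.add.r_cancel_one' l_one)
    thus ?case by simp
  next
    case (insert s S)
    have fc: "f x \<in> carrier R" "\<tau> x y \<in> carrier R" for x y
      using finsupp_closed[OF f] finsupp_closed[OF subsetD[OF syz_finsupp \<tau>]] by simp_all
    have \<phi>c: "\<phi> l \<in> carrier R" for l using \<phi> by auto
    have "(\<lambda>y. \<Oplus>x\<in>insert s S. f x \<otimes> \<tau> x y) = (\<lambda>y. (\<Oplus>x\<in>S. f x \<otimes> \<tau> x y) \<oplus> f s \<otimes> \<tau> s y)"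
      using insert fc by (intro ext, subst R.finsum_insert) (auto simp: R.a_comm)
    moreover have "(\<lambda>y. \<Oplus>x\<in>S. f x \<otimes> \<tau> x y) \<in> syz R M i"
      using insert fc \<tau> by (intro syz_finsum) auto
    moreover have "(\<Oplus>x\<in>insert s S. f x \<otimes> \<phi> (rel_label R (\<tau> x)))
      = (\<Oplus>x\<in>S. f x \<otimes> \<phi> (rel_label R (\<tau> x))) \<oplus> f s \<otimes> \<phi> (rel_label R (\<tau> s))"
      using insert fc \<phi>c by (subst R.finsum_insert) (auto simp: R.a_comm)
    ultimately show ?case using insert fc \<tau> by (simp add: cocycle_additive[OF \<phi>])
  qed
  show ?thesis unfolding lin_def dot_def using *[OF finsupp_finite[OF f]] .
qed

end

section \<open>Hom and quotient modules\<close>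

lemma module_hom_module:
  fixes R (structure) and M (structure) and N (structure)
  assumes "module R M" "module R N"
  shows "module R (hom_module R M N)"
proof -
  interpret M: module R M by fact
  interpret N: module R N by fact
  note closed = PiE_mem[where T = "\<lambda>_. carrier N"]
  show ?thesis
  proof (rule moduleI)
    show "abelian_group (hom_module R M N)"
    proof (rule abelian_groupI)
      fix f g assume "f \<in> carrier (hom_module R M N)" "g \<in> carrier (hom_module R M N)"
      thus "f \<oplus>\<^bsub>hom_module R M N\<^esub> g \<in> carrier (hom_module R M N)"
        by (auto simp: hom_module_def closed N.smult_r_distr N.a_ac)
    next
      fix f assume f: "f \<in> carrier (hom_module R M N)"
      hence "(\<lambda>x\<in>carrier M. \<ominus>\<^bsub>N\<^esub> f x) \<in> carrier (hom_module R M N)"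
        by (auto simp: hom_module_def closed N.minus_add N.smult_r_minus)
      moreover have "(\<lambda>x\<in>carrier M. \<ominus>\<^bsub>N\<^esub> f x) \<oplus>\<^bsub>hom_module R M N\<^esub> f = \<zero>\<^bsub>hom_module R M N\<^esub>"
        using f by (auto simp: hom_module_def closed N.l_neg fun_eq_iff)
      ultimately show "\<exists>g\<in>carrier (hom_module R M N). g \<oplus>\<^bsub>hom_module R M N\<^esub> f = \<zero>\<^bsub>hom_module R M N\<^esub>"
        by blast
    next
      show "\<zero>\<^bsub>hom_module R M N\<^esub> \<in> carrier (hom_module R M N)"
        by (auto simp: hom_module_def)
    next
      fix f assume f: "f \<in> carrier (hom_module R M N)"
      show "\<zero>\<^bsub>hom_module R M N\<^esub> \<oplus>\<^bsub>hom_module R M N\<^esub> f = f"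
        using f by (auto simp: hom_module_def restrict_def PiE_def extensional_def Pi_iff intro!: ext)
    qed (auto simp: hom_module_def closed N.a_ac fun_eq_iff)
  next
    fix a f assume "a \<in> carrier R" "f \<in> carrier (hom_module R M N)"
    thus "a \<odot>\<^bsub>hom_module R M N\<^esub> f \<in> carrier (hom_module R M N)"
      by (auto simp: hom_module_def closed N.smult_r_distr N.smult_assoc1[symmetric] M.R.m_comm)
  next
    fix f assume f: "f \<in> carrier (hom_module R M N)"
    show "\<one> \<odot>\<^bsub>hom_module R M N\<^esub> f = f"
      using f by (auto simp: hom_module_def restrict_def PiE_def extensional_def Pi_iff intro!: ext)
  qed (auto simp: hom_module_def closed N.smult_l_distr N.smult_r_distr N.smult_assoc1 fun_eq_iff M.R.is_cring)
qed

lemma (in cring) module_regular_module: "module R (regular_module R)"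
proof (rule moduleI)
  show "abelian_group (regular_module R)"
    by (rule abelian_groupI)
      (auto simp: regular_module_def a_ac intro: bexI[of _ "\<ominus> _"] l_neg)
qed (auto simp: regular_module_def l_distr r_distr m_assoc is_cring)

lemma (in module) annihilator_quotient_module:
  assumes N: "N \<subseteq> carrier M" "\<zero>\<^bsub>M\<^esub> \<in> N" and K: "K \<subseteq> carrier M"
    and add: "\<And>x y. x \<in> N \<Longrightarrow> y \<in> N \<Longrightarrow> x \<oplus>\<^bsub>M\<^esub> y \<in> N"
    and smult: "\<And>a x. a \<in> carrier R \<Longrightarrow> x \<in> N \<Longrightarrow> a \<odot>\<^bsub>M\<^esub> x \<in> N"
  shows "annihilator R (quotient_module (M\<lparr>carrier := K\<rparr>) N)
    = {a \<in> carrier R. \<forall>g\<in>K. a \<odot>\<^bsub>M\<^esub> g \<in> N}"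
proof -
  have uminus: "\<ominus>\<^bsub>M\<^esub> x \<in> N" if "x \<in> N" for x
    using smult[of "\<ominus> \<one>" x] that N by (auto simp: smult_l_minus)
  have coset: "a_r_coset (M\<lparr>carrier := K\<rparr>) N g = {n \<oplus>\<^bsub>M\<^esub> g |n. n \<in> N}" for g
    by (auto simp: a_r_coset_def r_coset_def)
  have carr: "carrier (quotient_module (M\<lparr>carrier := K\<rparr>) N) = (\<lambda>g. {n \<oplus>\<^bsub>M\<^esub> g |n. n \<in> N}) ` K"
    by (auto simp: quotient_module_def A_RCOSETS_def RCOSETS_def a_r_coset_def r_coset_def)
  have coset_eq: "{n \<oplus>\<^bsub>M\<^esub> g |n. n \<in> N} = N \<longleftrightarrow> g \<in> N" if g: "g \<in> carrier M" for g
  proof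
    assume "{n \<oplus>\<^bsub>M\<^esub> g |n. n \<in> N} = N"
    moreover have "\<zero>\<^bsub>M\<^esub> \<oplus>\<^bsub>M\<^esub> g \<in> {n \<oplus>\<^bsub>M\<^esub> g |n. n \<in> N}" using N by blast
    ultimately show "g \<in> N" using g by simp
  next
    assume gN: "g \<in> N"
    show "{n \<oplus>\<^bsub>M\<^esub> g |n. n \<in> N} = N"
    proof
      show "N \<subseteq> {n \<oplus>\<^bsub>M\<^esub> g |n. n \<in> N}"
      proof
        fix n assume n: "n \<in> N"
        hence "n = (n \<oplus>\<^bsub>M\<^esub> \<ominus>\<^bsub>M\<^esub> g) \<oplus>\<^bsub>M\<^esub> g" using g N by (auto simp: M.a_assoc M.l_neg)
        thus "n \<in> {n \<oplus>\<^bsub>M\<^esub> g |n. n \<in> N}" using add[OF n uminus[OF gN]] by blast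
      qed
    qed (use gN add in auto)
  qed
  \<comment> \<open>The union ranges over all representatives of one coset; they all contribute the
    same coset, because \<open>N\<close> is closed under multiplication by \<open>a\<close>.\<close>
  have smult_coset: "(\<Union>x\<in>{n \<oplus>\<^bsub>M\<^esub> g |n. n \<in> N}. {n \<oplus>\<^bsub>M\<^esub> a \<odot>\<^bsub>M\<^esub> x |n. n \<in> N})
      = {n \<oplus>\<^bsub>M\<^esub> a \<odot>\<^bsub>M\<^esub> g |n. n \<in> N}" if a: "a \<in> carrier R" and g: "g \<in> carrier M" for a g
  proof
    show "(\<Union>x\<in>{n \<oplus>\<^bsub>M\<^esub> g |n. n \<in> N}. {n \<oplus>\<^bsub>M\<^esub> a \<odot>\<^bsub>M\<^esub> x |n. n \<in> N})
      \<subseteq> {n \<oplus>\<^bsub>M\<^esub> a \<odot>\<^bsub>M\<^esub> g |n. n \<in> N}"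
    proof clarify
      fix x n m assume n: "n \<in> N" and m: "m \<in> N"
      have "m \<oplus>\<^bsub>M\<^esub> a \<odot>\<^bsub>M\<^esub> (n \<oplus>\<^bsub>M\<^esub> g) = (m \<oplus>\<^bsub>M\<^esub> a \<odot>\<^bsub>M\<^esub> n) \<oplus>\<^bsub>M\<^esub> a \<odot>\<^bsub>M\<^esub> g"
        using n m N(1) a g by (subst smult_r_distr) (auto simp: M.a_assoc subset_iff)
      thus "\<exists>n'. m \<oplus>\<^bsub>M\<^esub> a \<odot>\<^bsub>M\<^esub> (n \<oplus>\<^bsub>M\<^esub> g) = n' \<oplus>\<^bsub>M\<^esub> a \<odot>\<^bsub>M\<^esub> g \<and> n' \<in> N"
        using add[OF m smult[OF a n]] by blast
    qed
    have "g \<in> {n \<oplus>\<^bsub>M\<^esub> g |n. n \<in> N}" using N g by (auto intro!: exI[of _ "\<zero>\<^bsub>M\<^esub>"])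
    thus "{n \<oplus>\<^bsub>M\<^esub> a \<odot>\<^bsub>M\<^esub> g |n. n \<in> N}
      \<subseteq> (\<Union>x\<in>{n \<oplus>\<^bsub>M\<^esub> g |n. n \<in> N}. {n \<oplus>\<^bsub>M\<^esub> a \<odot>\<^bsub>M\<^esub> x |n. n \<in> N})" by blast
  qed
  have smult_Q: "a \<odot>\<^bsub>quotient_module (M\<lparr>carrier := K\<rparr>) N\<^esub> X
      = (\<Union>x\<in>X. {n \<oplus>\<^bsub>M\<^esub> a \<odot>\<^bsub>M\<^esub> x |n. n \<in> N})" for a X
    unfolding quotient_module_def by (simp add: coset)
  have zero_Q: "\<zero>\<^bsub>quotient_module (M\<lparr>carrier := K\<rparr>) N\<^esub> = N"
    by (simp add: quotient_module_def)
  have "a \<in> annihilator R (quotient_module (M\<lparr>carrier := K\<rparr>) N)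
      \<longleftrightarrow> (\<forall>g\<in>K. a \<odot>\<^bsub>M\<^esub> g \<in> N)" if a: "a \<in> carrier R" for a
  proof -
    have "a \<in> annihilator R (quotient_module (M\<lparr>carrier := K\<rparr>) N) \<longleftrightarrow>
      (\<forall>g\<in>K. (\<Union>x\<in>{n \<oplus>\<^bsub>M\<^esub> g |n. n \<in> N}. {n \<oplus>\<^bsub>M\<^esub> a \<odot>\<^bsub>M\<^esub> x |n. n \<in> N}) = N)"
      unfolding annihilator_def mem_Collect_eq carr smult_Q zero_Q by (simp add: a)
    also have "\<dots> \<longleftrightarrow> (\<forall>g\<in>K. {n \<oplus>\<^bsub>M\<^esub> a \<odot>\<^bsub>M\<^esub> g |n. n \<in> N} = N)"
      using smult_coset[OF a] K by (intro ball_cong refl) (simp add: subset_iff)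
    also have "\<dots> \<longleftrightarrow> (\<forall>g\<in>K. a \<odot>\<^bsub>M\<^esub> g \<in> N)"
      using a K by (intro ball_cong refl coset_eq smult_closed) auto
    finally show ?thesis .
  qed
  thus ?thesis unfolding annihilator_def by blast
qed

section \<open>Annihilators of Ext\<close>

context cring
begin

section \<open>Functionals on free modules as families of basis values\<close>

lemma single_in_free_module:
  assumes "e \<in> B" "a \<in> carrier R"
  shows "single e a \<in> carrier (free_module R B)"
proof -
  have "single e a x \<noteq> \<zero> \<Longrightarrow> x \<in> B" for x using assms(1) by (simp add: single_def split: if_splits)
  thus ?thesis using finsupp_single[OF assms(2)] by (simp add: carrier_free_module_on)
qed

lemma functional_closed:
  assumes "g \<in> carrier (hom_module R (free_module R B) (regular_module R))"
    and "f \<in> carrier (free_module R B)"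
  shows "g f \<in> carrier R"
  using assms by (auto simp: hom_module_def regular_module_def)

lemma functional_finsum:
  assumes g: "g \<in> carrier (hom_module R (free_module R B) (regular_module R))"
    and S: "finite S" "S \<subseteq> B" and c: "\<And>x. c x \<in> carrier R"
  shows "g (\<lambda>y. \<Oplus>x\<in>S. c x \<otimes> single x \<one> y) = (\<Oplus>x\<in>S. c x \<otimes> g (single x \<one>))"
  using S
proof (induction S rule: finite_induct)
  case empty
  have z: "(\<lambda>_. \<zero>) \<in> carrier (free_module R B)"
    by (simp add: carrier_free_module_on finsupp_zero)
  hence "g (\<zero> \<odot>\<^bsub>free_module R B\<^esub> (\<lambda>_. \<zero>)) = \<zero> \<otimes> g (\<lambda>_. \<zero>)" "g (\<lambda>_. \<zero>) \<in> carrier R"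
    using g by (auto simp: hom_module_def regular_module_def)
  thus ?case by (simp add: free_module_def)
next
  case (insert s S)
  let ?F = "free_module R B"
  have s: "single s \<one> \<in> carrier ?F"
    using insert.prems by (auto intro: single_in_free_module)
  have f: "(\<lambda>y. \<Oplus>x\<in>S. c x \<otimes> single x \<one> y) \<in> carrier ?F"
  proof -
    have "(\<Oplus>x\<in>S. c x \<otimes> single x \<one> y) = \<zero>" if "y \<notin> B" for y
    proof -
      have "(\<Oplus>x\<in>S. c x \<otimes> single x \<one> y) = (\<Oplus>x\<in>S. \<zero>)"
        using that insert.prems c by (intro finsum_cong') (auto simp: single_def)
      thus ?thesis by simp
    qed
    moreover have "(\<lambda>y. \<Oplus>x\<in>S. c x \<otimes> single x \<one> y) \<in> finsupp"
      using insert c by (intro finsupp_finsum) (auto simp: finsupp_single)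
    ultimately show ?thesis unfolding carrier_free_module_on by blast
  qed
  interpret F: module R ?F by (rule module_free_module)
  have gc: "g x \<in> carrier R" if "x \<in> carrier ?F" for x
    using g that by (auto simp: hom_module_def regular_module_def)
  have "(\<lambda>y. \<Oplus>x\<in>insert s S. c x \<otimes> single x \<one> y)
      = c s \<odot>\<^bsub>?F\<^esub> single s \<one> \<oplus>\<^bsub>?F\<^esub> (\<lambda>y. \<Oplus>x\<in>S. c x \<otimes> single x \<one> y)"
    using insert.hyps c unfolding free_module_def
    by (simp, intro ext finsum_insert) (auto simp: single_def)
  hence "g (\<lambda>y. \<Oplus>x\<in>insert s S. c x \<otimes> single x \<one> y)
      = c s \<otimes> g (single s \<one>) \<oplus> g (\<lambda>y. \<Oplus>x\<in>S. c x \<otimes> single x \<one> y)"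
    using g s f c by (simp add: hom_module_def regular_module_def)
  also have "\<dots> = c s \<otimes> g (single s \<one>) \<oplus> (\<Oplus>x\<in>S. c x \<otimes> g (single x \<one>))"
    using insert by simp
  also have "\<dots> = (\<Oplus>x\<in>insert s S. c x \<otimes> g (single x \<one>))"
  proof (rule finsum_insert[symmetric])
    have "single x \<one> \<in> carrier ?F" if "x \<in> S" for x
      using insert.prems that by (auto intro: single_in_free_module)
    thus "(\<lambda>x. c x \<otimes> g (single x \<one>)) \<in> S \<rightarrow> carrier R" using c gc by auto
  qed (use insert c gc s in auto)
  finally show ?case .
qed

text \<open>\<open>f\<close> is the finite sum of its coordinates times basis elements. The value
  zero outside \<open>B\<close> makes the family of basis values total; it never enters the
  sum.\<close>

lemma functional_eq_dot:
  assumes g: "g \<in> carrier (hom_module R (free_module R B) (regular_module R))"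
    and f: "f \<in> carrier (free_module R B)"
  shows "g f = dot f (\<lambda>e. if e \<in> B then g (single e \<one>) else \<zero>)"
proof -
  have fs: "f \<in> finsupp" "{x. f x \<noteq> \<zero>} \<subseteq> B" using f by (auto simp: carrier_free_module_on)
  have gc: "g (single x \<one>) \<in> carrier R" if "x \<in> B" for x
  proof -
    have "single x \<one> \<in> carrier (free_module R B)"
      using that by (auto intro: single_in_free_module)
    thus ?thesis using g by (auto simp: hom_module_def regular_module_def)
  qed
  have "g f = g (lin f (\<lambda>e. single e \<one>))"
    using finsupp_closed[OF fs(1)] by (simp add: lin_single[OF fs(1)])
  also have "\<dots> = (\<Oplus>x\<in>{x. f x \<noteq> \<zero>}. f x \<otimes> g (single x \<one>))"
    unfolding lin_def dot_def using fs
    by (intro functional_finsum[OF g]) (auto simp: finsupp_finite finsupp_closed)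
  also have "\<dots> = (\<Oplus>x\<in>{x. f x \<noteq> \<zero>}. f x \<otimes> (if x \<in> B then g (single x \<one>) else \<zero>))"
    using fs gc by (intro finsum_cong') (auto simp: finsupp_closed)
  also have "\<dots> = dot f (\<lambda>e. if e \<in> B then g (single e \<one>) else \<zero>)"
    by (simp add: dot_def)
  finally show ?thesis .
qed

lemma dot_functional:
  assumes "\<phi> \<in> UNIV \<rightarrow> carrier R"
  shows "(\<lambda>f\<in>carrier (free_module R B). dot f \<phi>)
    \<in> carrier (hom_module R (free_module R B) (regular_module R))"
proof -
  interpret F: module R "free_module R B" by (rule module_free_module)
  have eq: "f \<oplus>\<^bsub>free_module R B\<^esub> g = (\<lambda>x. f x \<oplus> g x)" "a \<odot>\<^bsub>free_module R B\<^esub> f = (\<lambda>x. a \<otimes> f x)" for a f g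
    by (simp_all add: free_module_def)
  have "f \<in> finsupp" if "f \<in> carrier (free_module R B)" for f
    using that by (simp add: carrier_free_module_on)
  thus ?thesis using assms F.a_closed F.smult_closed
    by (auto simp: hom_module_def regular_module_def dot_closed eq dot_add_left dot_smult_left)
qed

lemma lin_support:
  assumes "f \<in> finsupp" "lin f \<tau> y \<noteq> \<zero>"
  shows "\<exists>e. f e \<noteq> \<zero> \<and> \<tau> e y \<noteq> \<zero>"
proof (rule ccontr)
  assume "\<not> ?thesis"
  hence "lin f \<tau> y = dot f (\<lambda>_. \<zero>)"
    unfolding lin_def using assms(1) by (intro dot_cong) auto
  also have "\<dots> = (\<Oplus>x\<in>{x. f x \<noteq> \<zero>}. \<zero>)"
    unfolding dot_def using assms(1) by (intro finsum_cong') (auto simp: finsupp_closed)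
  finally show False using assms(2) by simp
qed

end

context module
begin

lemma lin_unlab_in_res:
  assumes "f \<in> carrier (free_module R (base (Suc i)))"
  shows "lin f unlab \<in> syz R M i"
  using assms syz_finsupp
  by (intro lin_in_syz) (auto simp: carrier_free_module_on subset_iff)

lemma syz_in_res: "f \<in> syz R M i \<Longrightarrow> f \<in> carrier (free_module R (base i))"
  using syz_finsupp syz_base by (auto simp: carrier_free_module_on)

section \<open>Cocycles, coboundaries and Ext in terms of basis values\<close>

text \<open>Each syzygy is the image of the basis element that it names. This is the exactness of
  the tautological resolution.\<close>

lemma single_rel_label:
  assumes "z \<in> syz R M i" "a \<in> carrier R"
  shows "single (rel_label R z) a \<in> carrier (free_module R (base (Suc i)))"
    and "lin (single (rel_label R z) a) unlab = (\<lambda>y. a \<otimes> z y)"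
proof -
  show "single (rel_label R z) a \<in> carrier (free_module R (base (Suc i)))"
    using assms by (intro single_in_free_module) auto
  have "z \<in> finsupp" using assms syz_finsupp by auto
  thus "lin (single (rel_label R z) a) unlab = (\<lambda>y. a \<otimes> z y)"
    using assms by (simp add: lin_def dot_single_left unlab_closed)
qed

text \<open>The image of the differential into \<open>F\<^sub>i\<close> is all of
  \<open>syz R M i\<close>, so composing \<open>g\<close> with the differential gives zero exactly
  when \<open>g\<close> vanishes there.\<close>

lemma mem_cocycles_iff:
  "g \<in> cocycles R i M (regular_module R) \<longleftrightarrow>
    g \<in> carrier (hom_module R (free_module R (base i)) (regular_module R)) \<and>
    (\<forall>z\<in>syz R M i. g z = \<zero>)"
proof -
  have "cochain_diff R i M g = \<zero>\<^bsub>cochain_module R (Suc i) M (regular_module R)\<^esub>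
    \<longleftrightarrow> (\<forall>f\<in>carrier (free_module R (base (Suc i))). g (lin f unlab) = \<zero>)" (is "?A \<longleftrightarrow> _")
  proof -
    have "?A \<longleftrightarrow> (\<forall>f\<in>carrier (res_module R M (Suc i)). g (res_diff R M i f) = \<zero>)"
      by (auto simp: cochain_diff_def cochain_module_def hom_module_def regular_module_def
          restrict_def fun_eq_iff)
    also have "\<dots> \<longleftrightarrow> (\<forall>f\<in>carrier (res_module R M (Suc i)). g (lin f unlab) = \<zero>)"
      by (intro ball_cong refl) (simp only: res_diff_eq)
    finally show ?thesis unfolding res_module_base .
  qed
  also have "\<dots> \<longleftrightarrow> (\<forall>z\<in>syz R M i. g z = \<zero>)"
  proof
    assume *: "\<forall>f\<in>carrier (free_module R (base (Suc i))). g (lin f unlab) = \<zero>"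
    show "\<forall>z\<in>syz R M i. g z = \<zero>"
    proof
      fix z assume z: "z \<in> syz R M i"
      have "(\<lambda>y. \<one> \<otimes> z y) = z" using subsetD[OF syz_finsupp z] by (simp add: finsupp_closed)
      thus "g z = \<zero>" using * single_rel_label[OF z one_closed] by metis
    qed
  qed (use lin_unlab_in_res in blast)
  finally show ?thesis unfolding cocycles_def cochain_module_def res_module_base by blast
qed

lemma mem_coboundaries_iff:
  "h \<in> coboundaries R (Suc i) M (regular_module R) \<longleftrightarrow>
    (\<exists>\<psi>\<in>UNIV \<rightarrow> carrier R. h = (\<lambda>f\<in>carrier (free_module R (base (Suc i))). dot (lin f unlab) \<psi>))"
proof -
  let ?H = "carrier (hom_module R (free_module R (base i)) (regular_module R))"
  let ?F = "carrier (free_module R (base (Suc i)))"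
  have diff: "cochain_diff R i M g = (\<lambda>f\<in>?F. g (lin f unlab))" for g :: "_ \<Rightarrow> 'a"
    unfolding cochain_diff_def res_module_base
    by (intro restrict_ext) (simp only: res_diff_eq[unfolded res_module_base])
  have res: "lin f unlab \<in> carrier (free_module R (base i))" if "f \<in> ?F" for f
    using lin_unlab_in_res[OF that] syz_in_res by blast
  have "h \<in> coboundaries R (Suc i) M (regular_module R) \<longleftrightarrow>
    (\<exists>g\<in>?H. h = (\<lambda>f\<in>?F. g (lin f unlab)))"
    unfolding coboundaries.simps cochain_module_def res_module_base image_iff diff ..
  also have "\<dots> \<longleftrightarrow> (\<exists>\<psi>\<in>UNIV \<rightarrow> carrier R. h = (\<lambda>f\<in>?F. dot (lin f unlab) \<psi>))"
  proof
    assume "\<exists>g\<in>?H. h = (\<lambda>f\<in>?F. g (lin f unlab))"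
    then obtain g where g: "g \<in> ?H" "h = (\<lambda>f\<in>?F. g (lin f unlab))" by blast
    let ?\<psi> = "\<lambda>e. if e \<in> base i then g (single e \<one>) else \<zero>"
    have "single e \<one> \<in> carrier (free_module R (base i))" if "e \<in> base i" for e
      using that by (auto intro: single_in_free_module)
    hence "?\<psi> \<in> UNIV \<rightarrow> carrier R" using functional_closed[OF g(1)] by simp
    moreover have "h = (\<lambda>f\<in>?F. dot (lin f unlab) ?\<psi>)"
      unfolding g(2) by (intro restrict_ext functional_eq_dot g(1) res)
    ultimately show "\<exists>\<psi>\<in>UNIV \<rightarrow> carrier R. h = (\<lambda>f\<in>?F. dot (lin f unlab) \<psi>)" by blast
  next
    assume "\<exists>\<psi>\<in>UNIV \<rightarrow> carrier R. h = (\<lambda>f\<in>?F. dot (lin f unlab) \<psi>)"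
    then obtain \<psi> where \<psi>: "\<psi> \<in> UNIV \<rightarrow> carrier R" "h = (\<lambda>f\<in>?F. dot (lin f unlab) \<psi>)" by blast
    have "h = (\<lambda>f\<in>?F. (\<lambda>f\<in>carrier (free_module R (base i)). dot f \<psi>) (lin f unlab))"
      unfolding \<psi>(2) by (intro restrict_ext) (simp only: res restrict_apply' )
    thus "\<exists>g\<in>?H. h = (\<lambda>f\<in>?F. g (lin f unlab))" using dot_functional[OF \<psi>(1)] by blast
  qed
  finally show ?thesis .
qed

lemma lin_unlab_finsupp: "f \<in> carrier (free_module R B) \<Longrightarrow> lin f unlab \<in> finsupp"
  by (rule finsupp_lin) (auto simp: carrier_free_module_on unlab_finsupp)

text \<open>Cochains are replaced by their basis values \<phi> and \<psi>. At the basis element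
  named by \<open>z\<close>, the coboundary of \<psi> has the value \<open>dot z \<psi>\<close>;
  hence the last equation says that \<open>a\<close> times the cocycle \<phi> is the coboundary of
  \<psi>.\<close>

lemma mem_annihilator_Ext_iff:
  "a \<in> annihilator R (Ext R (Suc i) M (regular_module R)) \<longleftrightarrow> a \<in> carrier R \<and>
    (\<forall>\<phi>\<in>UNIV \<rightarrow> carrier R. (\<forall>z\<in>syz R M (Suc i). dot z \<phi> = \<zero>) \<longrightarrow>
      (\<exists>\<psi>\<in>UNIV \<rightarrow> carrier R. \<forall>z\<in>syz R M i. a \<otimes> \<phi> (rel_label R z) = dot z \<psi>))"
proof -
  let ?F = "free_module R (base (Suc i))"
  let ?H = "hom_module R ?F (regular_module R)"
  let ?Bd = "coboundaries R (Suc i) M (regular_module R)"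
  let ?Cy = "cocycles R (Suc i) M (regular_module R)"
  have lf: "lin f unlab \<in> finsupp" if "f \<in> carrier ?F" for f
    using lin_unlab_finsupp that .
  have ff: "f \<in> finsupp" if "f \<in> carrier ?F" for f
    using that by (simp add: carrier_free_module_on)
  have add_H: "x \<oplus>\<^bsub>?H\<^esub> y = (\<lambda>f\<in>carrier ?F. x f \<oplus> y f)"
    and smult_H: "b \<odot>\<^bsub>?H\<^esub> x = (\<lambda>f\<in>carrier ?F. b \<otimes> x f)"
    and zero_H: "\<zero>\<^bsub>?H\<^esub> = (\<lambda>f\<in>carrier ?F. \<zero>)" for x y b
    by (simp_all add: hom_module_def regular_module_def)
  interpret H: module R ?H
    by (rule module_hom_module[OF module_free_module module_regular_module])
  have ann: "annihilator R (Ext R (Suc i) M (regular_module R)) = {a \<in> carrier R. \<forall>g\<in>?Cy. a \<odot>\<^bsub>?H\<^esub> g \<in> ?Bd}"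
    unfolding Ext_def cochain_module_def res_module_base
  proof (rule H.annihilator_quotient_module)
    show "?Bd \<subseteq> carrier ?H"
    proof
      fix h assume "h \<in> ?Bd"
      then obtain \<psi> where \<psi>: "\<psi> \<in> UNIV \<rightarrow> carrier R"
        "h = (\<lambda>f\<in>carrier ?F. dot (lin f unlab) \<psi>)" unfolding mem_coboundaries_iff by blast
      have "h = (\<lambda>f\<in>carrier ?F. dot f (\<lambda>l. dot (unlab l) \<psi>))"
        unfolding \<psi>(2) using ff \<psi>(1) by (intro restrict_ext dot_lin) (auto simp: unlab_finsupp)
      thus "h \<in> carrier ?H" using \<psi>(1) by (auto intro!: dot_functional dot_closed unlab_finsupp)
    qed
    have "\<zero>\<^bsub>?H\<^esub> = (\<lambda>f\<in>carrier ?F. dot (lin f unlab) (\<lambda>_. \<zero>))"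
      unfolding zero_H
    proof (intro restrict_ext)
      fix f assume "f \<in> carrier ?F"
      thus "\<zero> = dot (lin f unlab) (\<lambda>_. \<zero>)"
        using dot_smult_right[OF lf, of f "\<lambda>_. \<zero>" \<zero>] by (simp add: dot_closed lf)
    qed
    thus "\<zero>\<^bsub>?H\<^esub> \<in> ?Bd" unfolding mem_coboundaries_iff by (intro bexI[of _ "\<lambda>_. \<zero>"]) auto
    show "?Cy \<subseteq> carrier ?H" by (auto simp only: mem_cocycles_iff)
  next
    fix x y assume "x \<in> ?Bd" "y \<in> ?Bd"
    then obtain \<psi> \<psi>' where \<psi>: "\<psi> \<in> UNIV \<rightarrow> carrier R" "x = (\<lambda>f\<in>carrier ?F. dot (lin f unlab) \<psi>)"
        "\<psi>' \<in> UNIV \<rightarrow> carrier R" "y = (\<lambda>f\<in>carrier ?F. dot (lin f unlab) \<psi>')"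
      unfolding mem_coboundaries_iff by blast
    have "x \<oplus>\<^bsub>?H\<^esub> y = (\<lambda>f\<in>carrier ?F. dot (lin f unlab) (\<lambda>e. \<psi> e \<oplus> \<psi>' e))"
      unfolding add_H \<psi>(2,4) by (intro restrict_ext) (simp add: dot_add_right lf \<psi> del: base_simps)
    moreover have "(\<lambda>e. \<psi> e \<oplus> \<psi>' e) \<in> UNIV \<rightarrow> carrier R" using \<psi> by auto
    ultimately show "x \<oplus>\<^bsub>?H\<^esub> y \<in> ?Bd" unfolding mem_coboundaries_iff by blast
  next
    fix b x assume b: "b \<in> carrier R" and "x \<in> ?Bd"
    then obtain \<psi> where \<psi>: "\<psi> \<in> UNIV \<rightarrow> carrier R" "x = (\<lambda>f\<in>carrier ?F. dot (lin f unlab) \<psi>)"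
      unfolding mem_coboundaries_iff by blast
    have "b \<odot>\<^bsub>?H\<^esub> x = (\<lambda>f\<in>carrier ?F. dot (lin f unlab) (\<lambda>e. b \<otimes> \<psi> e))"
      unfolding smult_H \<psi>(2) by (intro restrict_ext) (simp add: dot_smult_right lf \<psi> b del: base_simps)
    moreover have "(\<lambda>e. b \<otimes> \<psi> e) \<in> UNIV \<rightarrow> carrier R" using \<psi> b by auto
    ultimately show "b \<odot>\<^bsub>?H\<^esub> x \<in> ?Bd" unfolding mem_coboundaries_iff by blast
  qed
  show ?thesis
  proof (cases "a \<in> carrier R")
    case a: True
    have "(\<forall>g\<in>?Cy. a \<odot>\<^bsub>?H\<^esub> g \<in> ?Bd) \<longleftrightarrow>
      (\<forall>\<phi>\<in>UNIV \<rightarrow> carrier R. (\<forall>z\<in>syz R M (Suc i). dot z \<phi> = \<zero>) \<longrightarrow>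
      (\<exists>\<psi>\<in>UNIV \<rightarrow> carrier R. \<forall>z\<in>syz R M i. a \<otimes> \<phi> (rel_label R z) = dot z \<psi>))"
    proof (intro iffI ballI impI)
      fix \<phi> :: "('a, 'c) label \<Rightarrow> 'a"
      assume ann: "\<forall>g\<in>?Cy. a \<odot>\<^bsub>?H\<^esub> g \<in> ?Bd" and \<phi>: "\<phi> \<in> UNIV \<rightarrow> carrier R"
        and cocycle: "\<forall>z\<in>syz R M (Suc i). dot z \<phi> = \<zero>"
      let ?g = "\<lambda>f\<in>carrier ?F. dot f \<phi>"
      have "?g \<in> ?Cy"
        unfolding mem_cocycles_iff
        using dot_functional[OF \<phi>] cocycle syz_in_res by (metis restrict_apply')
      with ann have "a \<odot>\<^bsub>?H\<^esub> ?g \<in> ?Bd" by blast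
      then obtain \<psi> where \<psi>: "\<psi> \<in> UNIV \<rightarrow> carrier R"
        "a \<odot>\<^bsub>?H\<^esub> ?g = (\<lambda>f\<in>carrier ?F. dot (lin f unlab) \<psi>)" unfolding mem_coboundaries_iff by blast
      have "a \<otimes> \<phi> (rel_label R z) = dot z \<psi>" if z: "z \<in> syz R M i" for z
      proof -
        \<comment> \<open>Evaluation at this basis element extracts the equation for
          \<open>z\<close> from the equality of functionals.\<close>
        let ?s = "single (rel_label R z) \<one>"
        have "(a \<odot>\<^bsub>?H\<^esub> ?g) ?s = a \<otimes> dot ?s \<phi>"
          unfolding smult_H using single_rel_label(1)[OF z one_closed] by simp
        moreover have "(\<lambda>f\<in>carrier ?F. dot (lin f unlab) \<psi>) ?s = dot (lin ?s unlab) \<psi>"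
          using single_rel_label(1)[OF z one_closed] by simp
        moreover have "lin ?s unlab = z"
          using single_rel_label(2)[OF z one_closed] subsetD[OF syz_finsupp z] by (simp add: finsupp_closed)
        moreover have "dot ?s \<phi> = \<phi> (rel_label R z)"
          using dot_single_left[OF one_closed \<phi>] \<phi> by (simp add: Pi_iff)
        ultimately show ?thesis using \<psi>(2) by simp
      qed
      thus "\<exists>\<psi>\<in>UNIV \<rightarrow> carrier R. \<forall>z\<in>syz R M i. a \<otimes> \<phi> (rel_label R z) = dot z \<psi>"
        using \<psi>(1) by blast
    next
      fix g
      assume *: "\<forall>\<phi>\<in>UNIV \<rightarrow> carrier R. (\<forall>z\<in>syz R M (Suc i). dot z \<phi> = \<zero>) \<longrightarrow>
          (\<exists>\<psi>\<in>UNIV \<rightarrow> carrier R. \<forall>z\<in>syz R M i. a \<otimes> \<phi> (rel_label R z) = dot z \<psi>)"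
        and g: "g \<in> ?Cy"
      let ?\<phi> = "\<lambda>e. if e \<in> base (Suc i) then g (single e \<one>) else \<zero>"
      have gH: "g \<in> carrier ?H" and gz: "\<forall>z\<in>syz R M (Suc i). g z = \<zero>"
        using g unfolding mem_cocycles_iff by auto
      have "single e \<one> \<in> carrier ?F" if "e \<in> base (Suc i)" for e
        using that by (auto intro: single_in_free_module)
      hence \<phi>: "?\<phi> \<in> UNIV \<rightarrow> carrier R" using functional_closed[OF gH] by simp
      have "\<forall>z\<in>syz R M (Suc i). dot z ?\<phi> = \<zero>"
      proof
        fix z assume z: "z \<in> syz R M (Suc i)"
        show "dot z ?\<phi> = \<zero>"
          using functional_eq_dot[OF gH syz_in_res[OF z]] bspec[OF gz z] by (rule trans[OF sym])
      qed
      from mp[OF bspec[OF * \<phi>] this] obtain \<psi> where \<psi>: "\<psi> \<in> UNIV \<rightarrow> carrier R"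
        "\<And>z. z \<in> syz R M i \<Longrightarrow> a \<otimes> ?\<phi> (rel_label R z) = dot z \<psi>" by blast
      have "a \<odot>\<^bsub>?H\<^esub> g = (\<lambda>f\<in>carrier ?F. dot (lin f unlab) \<psi>)"
        unfolding smult_H
      proof (intro restrict_ext)
        fix f assume f: "f \<in> carrier ?F"
        \<comment> \<open>Conversely, agreement on the labels in the support of \<open>f\<close>
          extends to \<open>f\<close> by linearity.\<close>
        have "a \<otimes> g f = dot f (\<lambda>e. a \<otimes> ?\<phi> e)"
          unfolding functional_eq_dot[OF gH f] by (rule dot_smult_right[OF ff[OF f] \<phi> a, symmetric])
        also have "\<dots> = dot f (\<lambda>l. dot (unlab l) \<psi>)"
        proof (rule dot_cong[OF ff[OF f]])
          show "(\<lambda>l. dot (unlab l) \<psi>) \<in> UNIV \<rightarrow> carrier R"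
            using \<psi>(1) by (auto intro!: dot_closed unlab_finsupp)
          fix l assume "f l \<noteq> \<zero>"
          then obtain z where z: "z \<in> syz R M i" "l = rel_label R z"
            using f by (auto simp: carrier_free_module_on)
          thus "a \<otimes> ?\<phi> l = dot (unlab l) \<psi>"
            using \<psi>(2)[OF z(1)] subsetD[OF syz_finsupp z(1)] by simp
        qed
        also have "\<dots> = dot (lin f unlab) \<psi>"
          by (rule dot_lin[OF ff[OF f] _ \<psi>(1), symmetric]) (simp add: unlab_finsupp)
        finally show "a \<otimes> g f = dot (lin f unlab) \<psi>" .
      qed
      thus "a \<odot>\<^bsub>?H\<^esub> g \<in> ?Bd" unfolding mem_coboundaries_iff using \<psi>(1) by blast
    qed
    thus ?thesis unfolding ann using a by (simp only: mem_Collect_eq simp_thms)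
  qed (simp add: ann)
qed

text \<open>An element \<open>a\<close> of the annihilator of \<open>M\<close> acts as zero up to homotopy on the resolution.
  Rather than the homotopy itself, what is needed is that multiplication by \<open>a\<close> on the \<open>i\<close>-th
  syzygy module extends to a map \<open>F\<^sub>i \<rightarrow> syz R M i\<close>, given here by its values \<open>\<tau>\<close> on the basis.\<close>

lemma syz_mult_extends:
  assumes "a \<in> annihilator R M"
  shows "\<exists>\<tau>. (\<forall>e. \<tau> e \<in> syz R M i) \<and> (\<forall>z\<in>syz R M i. lin z \<tau> = (\<lambda>y. a \<otimes> z y))"
proof (induction i)
  have a: "a \<in> carrier R" using assms by (simp add: annihilator_def)
  case 0
  \<comment> \<open>In degree 0 the extension is multiplication by \<open>a\<close> on the whole
    free module; it lands in the kernel of the augmentation because \<open>a\<close> kills the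
    module.\<close>
  let ?\<tau> = "\<lambda>e. if e \<in> base 0 then single e a else (\<lambda>_. \<zero>)"
  have "?\<tau> e \<in> syz R M 0" for e
  proof (cases "e \<in> base 0")
    case True
    then obtain m where m: "m \<in> carrier M" "e = Gen m" by auto
    hence "aug (single e a) = \<zero>\<^bsub>M\<^esub>" using assms aug_single a by (simp add: annihilator_def)
    moreover have "{x. single e a x \<noteq> \<zero>} \<subseteq> base 0"
      using True by (auto simp: single_def split: if_splits)
    ultimately show ?thesis using True finsupp_single[OF a] by (simp add: syz_0_iff del: base_simps)
  qed (simp add: syz_zero)
  moreover have "lin z ?\<tau> = (\<lambda>y. a \<otimes> z y)" if z: "z \<in> syz R M 0" for z
  proof
    fix y
    have zf: "z \<in> finsupp" using z syz_finsupp by auto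
    have "lin z ?\<tau> y = dot z (\<lambda>e. single e a y)"
      unfolding lin_def using syz_base[OF z] a
      by (intro dot_cong[OF zf]) (auto simp: single_def)
    thus "lin z ?\<tau> y = a \<otimes> z y"
      using dot_delta_right[OF zf a] finsupp_closed[OF zf] a by (simp add: R.m_comm)
  qed
  ultimately show ?case by (intro exI[of _ ?\<tau>]) blast
next
  have a: "a \<in> carrier R" using assms by (simp add: annihilator_def)
  case (Suc i)
  then obtain \<tau> where \<tau>: "\<And>e. \<tau> e \<in> syz R M i"
    "\<And>z. z \<in> syz R M i \<Longrightarrow> lin z \<tau> = (\<lambda>y. a \<otimes> z y)" by blast
  \<comment> \<open>\<sigma> lifts \<tau> through the differential: it sends \<open>e\<close> to the
    basis element that names \<open>\<tau> e\<close>. It is the homotopy from degree i to degree i +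
    1.\<close>
  define \<sigma> where "\<sigma> = (\<lambda>e. single (rel_label R (\<tau> e)) \<one>)"
  have \<sigma>: "\<sigma> \<in> UNIV \<rightarrow> finsupp" by (auto simp: \<sigma>_def finsupp_single)
  have \<sigma>c: "(\<lambda>e. \<sigma> e y) \<in> UNIV \<rightarrow> carrier R" for y by (simp add: \<sigma>_def single_def)
  have \<tau>f: "\<tau> e \<in> finsupp" for e using \<tau>(1) syz_finsupp by auto
  \<comment> \<open>Multiplication by \<open>a\<close> minus \<sigma> after the differential. On the
    basis element named by \<open>w\<close>, the differential of this is \<open>a\<close> times
    \<open>w\<close> minus \<open>lin w \<tau>\<close>, which is zero by induction.\<close>
  let ?t = "\<lambda>l y. single l a y \<oplus> \<ominus> (lin (unlab l) \<sigma> y)"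
  let ?\<tau> = "\<lambda>l. if l \<in> base (Suc i) then ?t l else (\<lambda>_. \<zero>)"
  have lf: "lin (unlab l) \<sigma> \<in> finsupp" for l by (rule finsupp_lin[OF unlab_finsupp \<sigma>])
  have tf: "?t l \<in> finsupp" for l
    using lf a by (intro finsupp_add finsupp_single finsupp_uminus)
  have "?t (rel_label R w) \<in> syz R M (Suc i)" if w: "w \<in> syz R M i" for w
    unfolding syz_Suc_iff
  proof (intro conjI tf)
    have wf: "w \<in> finsupp" using w syz_finsupp by auto
    let ?l = "rel_label R w"
    show "{x. ?t ?l x \<noteq> \<zero>} \<subseteq> base (Suc i)"
    proof
      fix y assume "y \<in> {x. ?t ?l x \<noteq> \<zero>}"
      hence "single ?l a y \<noteq> \<zero> \<or> lin w \<sigma> y \<noteq> \<zero>" using wf by auto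
      thus "y \<in> base (Suc i)"
      proof
        assume "lin w \<sigma> y \<noteq> \<zero>"
        from lin_support[OF wf this] obtain e where "\<sigma> e y \<noteq> \<zero>" by auto
        thus ?thesis using \<tau>(1) by (auto simp: \<sigma>_def single_def split: if_splits)
      qed (use w in \<open>auto simp: single_def split: if_splits\<close>)
    qed
    show "lin (?t ?l) unlab = (\<lambda>_. \<zero>)"
    proof
      fix y
      have "lin (?t ?l) unlab y = dot (single ?l a) (\<lambda>l. unlab l y) \<oplus> \<ominus> dot (lin (unlab ?l) \<sigma>) (\<lambda>l. unlab l y)"
        unfolding lin_def[of _ unlab]
        by (simp add: dot_add_left finsupp_single a finsupp_uminus lf unlab_closed dot_uminus_left)
      also have "dot (single ?l a) (\<lambda>l. unlab l y) = a \<otimes> w y"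
        using wf by (simp add: dot_single_left a unlab_closed)
      also have "dot (lin (unlab ?l) \<sigma>) (\<lambda>l. unlab l y) = dot w (\<lambda>e. dot (\<sigma> e) (\<lambda>l. unlab l y))"
        using wf by (simp add: dot_lin \<sigma> unlab_closed)
      also have "(\<lambda>e. dot (\<sigma> e) (\<lambda>l. unlab l y)) = (\<lambda>e. \<tau> e y)"
        unfolding \<sigma>_def by (simp add: dot_single_left unlab_closed \<tau>f finsupp_closed)
      also have "dot w (\<lambda>e. \<tau> e y) = a \<otimes> w y" using \<tau>(2)[OF w] by (simp add: lin_def fun_eq_iff)
      finally show "lin (?t ?l) unlab y = \<zero>" using a wf by (simp add: finsupp_closed R.r_neg)
    qed
  qed
  hence "?\<tau> l \<in> syz R M (Suc i)" for l by (auto simp: syz_zero)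
  moreover have "lin z ?\<tau> = (\<lambda>y. a \<otimes> z y)" if z: "z \<in> syz R M (Suc i)" for z
  proof
    fix y
    have zf: "z \<in> finsupp" and z0: "lin z unlab = (\<lambda>_. \<zero>)" using z by (auto simp: syz_Suc_iff)
    have c: "(\<lambda>l. single l a y) \<in> UNIV \<rightarrow> carrier R" "(\<lambda>l. lin (unlab l) \<sigma> y) \<in> UNIV \<rightarrow> carrier R"
      using a finsupp_closed[OF lf] by (simp_all add: single_def)
    have "lin z ?\<tau> y = dot z (\<lambda>l. ?t l y)"
      unfolding lin_def[of z] using syz_base[OF z] finsupp_closed[OF tf]
      by (intro dot_cong[OF zf]) auto
    also have "\<dots> = z y \<otimes> a \<oplus> \<ominus> dot z (\<lambda>l. lin (unlab l) \<sigma> y)"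
    proof -
      have "(\<lambda>l. \<ominus> (lin (unlab l) \<sigma> y)) \<in> UNIV \<rightarrow> carrier R" using c(2) by auto
      thus ?thesis using c by (simp add: dot_add_right zf dot_uminus_right dot_delta_right a)
    qed
    \<comment> \<open>On a syzygy the correction term vanishes, being \<sigma> applied to the
      differential of \<open>z\<close>; only multiplication by \<open>a\<close> survives.\<close>
    also have "dot z (\<lambda>l. lin (unlab l) \<sigma> y) = lin (lin z unlab) \<sigma> y"
    proof -
      have "unlab \<in> UNIV \<rightarrow> finsupp" using unlab_finsupp by blast
      from fun_cong[OF lin_lin[OF zf this \<sigma>], of y] show ?thesis by (simp add: lin_def[of z])
    qed
    also have "\<dots> = \<zero>" unfolding z0 by (simp add: lin_def dot_zero)
    finally show "lin z ?\<tau> y = a \<otimes> z y" using a finsupp_closed[OF zf] by (simp add: R.m_comm)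
  qed
  ultimately show ?case by (intro exI[of _ ?\<tau>]) blast
qed

text \<open>Linearity of \<phi> on syzygies rewrites \<open>a\<close> times its value at
  \<open>z\<close> as its value at \<open>lin z \<tau>\<close>, which is \<open>dot z\<close> of the
  values at the \<open>\<tau> e\<close>. These values form the required \<psi>.\<close>

lemma annihilator_subset_annihilator_Ext:
  "annihilator R M \<subseteq> annihilator R (Ext R (Suc i) M (regular_module R))"
proof
  fix a assume ann: "a \<in> annihilator R M"
  hence a: "a \<in> carrier R" by (simp add: annihilator_def)
  obtain \<tau> where \<tau>: "\<And>e. \<tau> e \<in> syz R M i"
    "\<And>z. z \<in> syz R M i \<Longrightarrow> lin z \<tau> = (\<lambda>y. a \<otimes> z y)" using syz_mult_extends[OF ann] by blast
  show "a \<in> annihilator R (Ext R (Suc i) M (regular_module R))"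
    unfolding mem_annihilator_Ext_iff
  proof (intro conjI a ballI impI)
    fix \<phi> :: "('a, 'c) label \<Rightarrow> 'a"
    assume \<phi>: "\<phi> \<in> UNIV \<rightarrow> carrier R" "\<forall>z\<in>syz R M (Suc i). dot z \<phi> = \<zero>"
    have lin: "\<phi> (rel_label R (lin f \<tau>')) = dot f (\<lambda>e. \<phi> (rel_label R (\<tau>' e)))"
      if "f \<in> finsupp" "\<And>e. \<tau>' e \<in> syz R M i" for f :: "('a, 'c) label \<Rightarrow> 'a" and \<tau>'
      by (rule cocycle_lin[OF \<phi>(1) _ that]) (use \<phi>(2) in blast)+
    have "a \<otimes> \<phi> (rel_label R z) = dot z (\<lambda>e. \<phi> (rel_label R (\<tau> e)))" if z: "z \<in> syz R M i" for z
    proof -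
      have zf: "z \<in> finsupp" using z syz_finsupp by auto
      \<comment> \<open>A dummy one-element index: the combination with coefficient \<open>a\<close>
        and the constant family \<open>z\<close> turns linearity into homogeneity.\<close>
      let ?s = "single (Gen undefined :: ('a, 'c) label) a"
      have s: "lin ?s (\<lambda>_. z) = (\<lambda>y. a \<otimes> z y)"
        unfolding lin_def using finsupp_closed[OF zf] a by (simp add: dot_single_left)
      have "a \<otimes> \<phi> (rel_label R z) = dot ?s (\<lambda>_. \<phi> (rel_label R z))"
        using \<phi>(1) a by (subst dot_single_left) auto
      also have "\<dots> = \<phi> (rel_label R (lin ?s (\<lambda>_. z)))"
        using lin[OF finsupp_single[OF a] z] by simp
      also have "\<dots> = dot z (\<lambda>e. \<phi> (rel_label R (\<tau> e)))"
        unfolding s \<tau>(2)[OF z, symmetric] using lin[OF zf \<tau>(1)] .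
      finally show ?thesis .
    qed
    thus "\<exists>\<psi>\<in>UNIV \<rightarrow> carrier R. \<forall>z\<in>syz R M i. a \<otimes> \<phi> (rel_label R z) = dot z \<psi>"
      using \<phi>(1) by (intro bexI[of _ "\<lambda>e. \<phi> (rel_label R (\<tau> e))"]) auto
  qed
qed

end

section \<open>Ext up to torsion modulo a regular element\<close>

context cring
begin

section \<open>Arithmetic of congruences modulo an ideal\<close>

lemma ideal_minus_smult_congruence:
  assumes "ideal J R" "c \<in> carrier R" "p \<in> carrier R" "q \<in> carrier R" "s \<in> carrier R" "x \<in> carrier R"
    and "p \<ominus> x \<otimes> s \<in> J" "c \<otimes> s \<ominus> q \<in> J"
  shows "c \<otimes> p \<ominus> x \<otimes> q \<in> J"
proof -
  interpret J: ideal J R by fact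
  have "c \<otimes> p \<ominus> x \<otimes> q = c \<otimes> (p \<ominus> x \<otimes> s) \<oplus> x \<otimes> (c \<otimes> s \<ominus> q)"
    using assms(2-6) by algebra
  thus ?thesis using assms(2,6,7,8) J.I_l_closed J.a_closed by simp
qed

lemma ideal_minus_absorb:
  assumes "ideal J R" "d \<in> carrier R" "p \<in> carrier R" "q \<in> carrier R" "t \<in> carrier R" "x \<in> J"
    and "d \<otimes> (p \<ominus> x \<otimes> t) \<ominus> q \<in> J"
  shows "d \<otimes> p \<ominus> q \<in> J"
proof -
  interpret J: ideal J R by fact
  have x: "x \<in> carrier R" using ideal.Icarr[OF assms(1,6)] .
  have "d \<otimes> p \<ominus> q = (d \<otimes> (p \<ominus> x \<otimes> t) \<ominus> q) \<oplus> (d \<otimes> t) \<otimes> x"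
    using assms(2-5) x by algebra
  thus ?thesis using assms J.I_l_closed J.a_closed by simp
qed

lemma ideal_minus_trans:
  assumes "ideal J R" "p \<ominus> q \<in> J" "q \<ominus> s \<in> J" "p \<in> carrier R" "q \<in> carrier R" "s \<in> carrier R"
  shows "p \<ominus> s \<in> J"
proof -
  interpret J: ideal J R by fact
  have "p \<ominus> s = (p \<ominus> q) \<oplus> (q \<ominus> s)" using assms(4-6) by algebra
  thus ?thesis using assms(2,3) J.a_closed by simp
qed

lemma ideal_minus_add:
  assumes "ideal J R" "p \<ominus> q \<in> J" "p' \<ominus> q' \<in> J"
    "p \<in> carrier R" "q \<in> carrier R" "p' \<in> carrier R" "q' \<in> carrier R"
  shows "(p \<oplus> p') \<ominus> (q \<oplus> q') \<in> J"
proof -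
  interpret J: ideal J R by fact
  have "(p \<oplus> p') \<ominus> (q \<oplus> q') = (p \<ominus> q) \<oplus> (p' \<ominus> q')" using assms(4-7) by algebra
  thus ?thesis using assms(2,3) J.a_closed by simp
qed

lemma ideal_minus_mem:
  assumes "ideal J R" "p \<ominus> q \<in> J" "p \<in> carrier R" "q \<in> carrier R"
  shows "p \<in> J \<longleftrightarrow> q \<in> J"
proof -
  interpret J: ideal J R by fact
  have "p = (p \<ominus> q) \<oplus> q" "q = p \<oplus> \<ominus> (p \<ominus> q)" using assms(3,4) by algebra+
  thus ?thesis using assms(2) J.a_closed J.a_inv_closed by metis
qed

end

context module
begin

text \<open>Some power of \<open>r\<close> annihilates \<open>Ext\<^sup>0(M, R/J)\<close> (first conjunct), and the same for
  \<open>Ext\<^sup>i\<^sup>+\<^sup>1(M, R/J)\<close> (second conjunct), with cochains modulo \<open>J\<close> lifted to functions on labels.\<close>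

definition ext_torsion :: "'a \<Rightarrow> 'a set \<Rightarrow> bool" where
  "ext_torsion r J \<longleftrightarrow>
    (\<exists>n::nat. \<forall>\<phi>\<in>UNIV \<rightarrow> carrier R. (\<forall>z\<in>syz R M 0. dot z \<phi> \<in> J) \<longrightarrow>
       (\<forall>x\<in>base 0. r [^] n \<otimes> \<phi> x \<in> J)) \<and>
    (\<forall>i. \<exists>n::nat. \<forall>\<phi>\<in>UNIV \<rightarrow> carrier R. (\<forall>z\<in>syz R M (Suc i). dot z \<phi> \<in> J) \<longrightarrow>
       (\<exists>\<psi>\<in>UNIV \<rightarrow> carrier R. \<forall>z\<in>syz R M i. r [^] n \<otimes> \<phi> (rel_label R z) \<ominus> dot z \<psi> \<in> J))"

text \<open>This is the connecting map to degree k + 1. Dividing the values of \<phi> on syzygies by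
  \<open>x\<close> gives \<psi>, a cocycle modulo \<open>J\<close> once multiplied by a power of
  \<open>r\<close>. A further power makes it the coboundary of some \<theta>, and subtracting
  \<open>x\<close> times \<theta> corrects the multiple of \<phi> to a cocycle modulo
  \<open>J\<close>.\<close>

lemma ext_torsion_lift:
  assumes T: "ext_torsion r J" and J: "ideal J R" and r: "r \<in> carrier R" and x: "x \<in> carrier R"
    and reg: "\<And>y. y \<in> carrier R \<Longrightarrow> x \<otimes> y \<in> J \<Longrightarrow> r [^] (N::nat) \<otimes> y \<in> J"
    and J1: "\<And>w. w \<in> J1 \<Longrightarrow> \<exists>y\<in>carrier R. w \<ominus> x \<otimes> y \<in> J"
  shows "\<exists>m::nat. \<forall>\<phi>\<in>UNIV \<rightarrow> carrier R. (\<forall>z\<in>syz R M k. dot z \<phi> \<in> J1) \<longrightarrow>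
    (\<exists>\<theta>\<in>UNIV \<rightarrow> carrier R. \<forall>z\<in>syz R M k. dot z (\<lambda>e. r [^] m \<otimes> \<phi> e \<ominus> x \<otimes> \<theta> e) \<in> J)"
proof -
  obtain n :: nat where n: "\<And>\<phi>. \<phi> \<in> UNIV \<rightarrow> carrier R \<Longrightarrow> (\<And>z. z \<in> syz R M (Suc k) \<Longrightarrow> dot z \<phi> \<in> J) \<Longrightarrow>
       (\<exists>\<psi>\<in>UNIV \<rightarrow> carrier R. \<forall>z\<in>syz R M k. r [^] n \<otimes> \<phi> (rel_label R z) \<ominus> dot z \<psi> \<in> J)"
    using T unfolding ext_torsion_def by meson
  show ?thesis
  \<comment> \<open>\<open>N\<close> pays for cancelling \<open>x\<close> modulo \<open>J\<close>,
    and \<open>n\<close> for killing the class of \<psi> in degree k + 1.\<close>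
  proof (intro exI[of _ "n + N"] ballI impI)
    fix \<phi> :: "('a, 'c) label \<Rightarrow> 'a"
    assume \<phi>: "\<phi> \<in> UNIV \<rightarrow> carrier R" and co: "\<forall>z\<in>syz R M k. dot z \<phi> \<in> J1"
    let ?P = "\<lambda>l y. y \<in> carrier R \<and> (l \<in> rel_label R ` syz R M k \<longrightarrow> dot (unlab l) \<phi> \<ominus> x \<otimes> y \<in> J)"
    have "\<exists>y. ?P l y" for l
    proof (cases "l \<in> rel_label R ` syz R M k")
      case True
      then obtain z where z: "z \<in> syz R M k" "l = rel_label R z" by blast
      hence "unlab l = z" using subsetD[OF syz_finsupp z(1)] by simp
      thus ?thesis using J1[of "dot z \<phi>"] co z by auto
    qed (use R.zero_closed in blast)
    then obtain \<psi> where \<psi>: "\<And>l. ?P l (\<psi> l)" by metis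
    hence \<psi>c: "\<psi> \<in> UNIV \<rightarrow> carrier R" by auto
    have \<psi>J: "dot z \<phi> \<ominus> x \<otimes> \<psi> (rel_label R z) \<in> J" if "z \<in> syz R M k" for z
      using \<psi>[of "rel_label R z"] that subsetD[OF syz_finsupp that] by simp
    have rc: "r [^] m \<in> carrier R" for m :: nat using r by simp
    have uc: "(\<lambda>l. dot (unlab l) \<phi>) \<in> UNIV \<rightarrow> carrier R" using \<phi> by (simp add: dot_closed unlab_finsupp)
    \<comment> \<open>Modulo \<open>J\<close>, \<open>x\<close> times \<open>dot w \<psi>\<close> is
      \<phi> applied to the differential of \<open>w\<close>, which is zero. Cancelling
      \<open>x\<close> costs the factor \<open>r [^] N\<close>.\<close>
    have "dot w (\<lambda>l. r [^] N \<otimes> \<psi> l) \<in> J" if w: "w \<in> syz R M (Suc k)" for w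
    proof -
      have wf: "w \<in> finsupp" and w0: "lin w unlab = (\<lambda>_. \<zero>)" using w by (auto simp: syz_Suc_iff)
      have xc: "(\<lambda>l. x \<otimes> \<psi> l) \<in> UNIV \<rightarrow> carrier R" "(\<lambda>l. \<ominus> (x \<otimes> \<psi> l)) \<in> UNIV \<rightarrow> carrier R"
        using \<psi>c x by auto
      have dc: "dot w \<psi> \<in> carrier R" using wf \<psi>c by (rule dot_closed)
      have "dot w (\<lambda>l. dot (unlab l) \<phi> \<oplus> \<ominus> (x \<otimes> \<psi> l)) \<in> J"
      proof (rule dot_in_ideal[OF J wf])
        fix l assume "w l \<noteq> \<zero>"
        hence "l \<in> rel_label R ` syz R M k" using syz_base[OF w] by simp
        thus "dot (unlab l) \<phi> \<oplus> \<ominus> (x \<otimes> \<psi> l) \<in> J" using \<psi>[of l] unfolding a_minus_def by blast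
      qed
      also have "dot w (\<lambda>l. dot (unlab l) \<phi> \<oplus> \<ominus> (x \<otimes> \<psi> l))
          = dot w (\<lambda>l. dot (unlab l) \<phi>) \<oplus> \<ominus> (x \<otimes> dot w \<psi>)"
        using wf uc xc \<psi>c x by (simp only: dot_add_right dot_uminus_right dot_smult_right)
      also have "dot w (\<lambda>l. dot (unlab l) \<phi>) = dot (lin w unlab) \<phi>"
        by (rule dot_lin[OF wf _ \<phi>, symmetric]) (simp add: unlab_finsupp)
      also have "\<dots> = \<zero>" unfolding w0 by (rule dot_zero)
      finally have "\<zero> \<oplus> \<ominus> (x \<otimes> dot w \<psi>) \<in> J" .
      hence "\<ominus> (\<zero> \<oplus> \<ominus> (x \<otimes> dot w \<psi>)) \<in> J"
        by (rule additive_subgroup.a_inv_closed[OF ideal.axioms(1)[OF J]])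
      hence "x \<otimes> dot w \<psi> \<in> J" using x dc by simp
      hence "r [^] N \<otimes> dot w \<psi> \<in> J" by (rule reg[OF dc])
      thus ?thesis using wf \<psi>c rc by (simp add: dot_smult_right)
    qed
    moreover have "(\<lambda>l. r [^] N \<otimes> \<psi> l) \<in> UNIV \<rightarrow> carrier R" using \<psi>c rc by auto
    ultimately obtain \<theta> where \<theta>: "\<theta> \<in> UNIV \<rightarrow> carrier R"
      "\<And>z. z \<in> syz R M k \<Longrightarrow> r [^] n \<otimes> (r [^] N \<otimes> \<psi> (rel_label R z)) \<ominus> dot z \<theta> \<in> J"
      using n[of "\<lambda>l. r [^] N \<otimes> \<psi> l"] by blast
    have "dot z (\<lambda>e. r [^] (n + N) \<otimes> \<phi> e \<ominus> x \<otimes> \<theta> e) \<in> J" if z: "z \<in> syz R M k" for z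
    proof -
      have zf: "z \<in> finsupp" using z syz_finsupp by blast
      have c: "(\<lambda>e. r [^] (n + N) \<otimes> \<phi> e) \<in> UNIV \<rightarrow> carrier R" "(\<lambda>e. \<ominus> (x \<otimes> \<theta> e)) \<in> UNIV \<rightarrow> carrier R"
        "(\<lambda>e. x \<otimes> \<theta> e) \<in> UNIV \<rightarrow> carrier R"
        using \<phi> \<theta>(1) x rc by auto
      have \<psi>z: "\<psi> (rel_label R z) \<in> carrier R" using \<psi>c by blast
      have "r [^] (n + N) \<otimes> \<psi> (rel_label R z) \<ominus> dot z \<theta> \<in> J"
        using \<theta>(2)[OF z] \<psi>z r by (simp add: nat_pow_mult[symmetric] m_assoc)
      hence "r [^] (n + N) \<otimes> dot z \<phi> \<ominus> x \<otimes> dot z \<theta> \<in> J"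
        using ideal_minus_smult_congruence[OF J rc _ _ \<psi>z x \<psi>J[OF z]] dot_closed[OF zf] \<phi> \<theta>(1) by blast
      also have "r [^] (n + N) \<otimes> dot z \<phi> \<ominus> x \<otimes> dot z \<theta> = dot z (\<lambda>e. r [^] (n + N) \<otimes> \<phi> e \<ominus> x \<otimes> \<theta> e)"
        using zf c \<phi> \<theta>(1) x rc[of "n + N"]
        by (simp only: a_minus_def dot_add_right dot_uminus_right dot_smult_right)
      finally show ?thesis .
    qed
    thus "\<exists>\<theta>\<in>UNIV \<rightarrow> carrier R. \<forall>z\<in>syz R M k. dot z (\<lambda>e. r [^] (n + N) \<otimes> \<phi> e \<ominus> x \<otimes> \<theta> e) \<in> J"
      using \<theta>(1) by blast
  qed
qed

text \<open>This replaces the long exact \<open>Ext\<close> sequence of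
  \<open>0 \<rightarrow> R/J \<rightarrow> R/J \<rightarrow> R/(J + xR) \<rightarrow> 0\<close>, where the first map, multiplication by \<open>x\<close>,
  is injective up to \<open>r\<close>-torsion.\<close>

lemma ext_torsion_add_regular:
  assumes T: "ext_torsion r J" and J: "ideal J R" and r: "r \<in> carrier R" and x: "x \<in> carrier R"
    and reg: "\<And>y. y \<in> carrier R \<Longrightarrow> x \<otimes> y \<in> J \<Longrightarrow> r [^] (N::nat) \<otimes> y \<in> J"
    and I1: "ideal J1 R" "J \<subseteq> J1" "x \<in> J1"
    and J1: "\<And>w. w \<in> J1 \<Longrightarrow> \<exists>y\<in>carrier R. w \<ominus> x \<otimes> y \<in> J"
  shows "ext_torsion r J1"
proof -
  note lift = ext_torsion_lift[OF T J r x reg J1]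
  have rc: "r [^] m \<in> carrier R" for m :: nat using r by simp
  have pw: "r [^] (n + m) \<otimes> y = r [^] n \<otimes> (r [^] m \<otimes> y)" if "y \<in> carrier R" for n m :: nat and y
    using that r by (simp add: nat_pow_mult[symmetric] m_assoc)
  have c: "(\<lambda>e. r [^] m \<otimes> \<phi> e \<ominus> x \<otimes> \<theta> e) \<in> UNIV \<rightarrow> carrier R"
    if "\<phi> \<in> UNIV \<rightarrow> carrier R" "\<theta> \<in> UNIV \<rightarrow> carrier R" for m :: nat and \<phi> \<theta> :: "('a, 'c) label \<Rightarrow> 'a"
    using that x rc by (simp add: Pi_iff R.minus_closed)
  show ?thesis
    unfolding ext_torsion_def
  proof (intro conjI allI)
    obtain m :: nat where m: "\<forall>\<phi>\<in>UNIV \<rightarrow> carrier R. (\<forall>z\<in>syz R M 0. dot z \<phi> \<in> J1) \<longrightarrow>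
      (\<exists>\<theta>\<in>UNIV \<rightarrow> carrier R. \<forall>z\<in>syz R M 0. dot z (\<lambda>e. r [^] m \<otimes> \<phi> e \<ominus> x \<otimes> \<theta> e) \<in> J)"
      using lift[where k = 0] by (rule exE)
    obtain n :: nat where n: "\<And>\<phi> e. \<phi> \<in> UNIV \<rightarrow> carrier R \<Longrightarrow> (\<forall>z\<in>syz R M 0. dot z \<phi> \<in> J) \<Longrightarrow> 
        e \<in> base 0 \<Longrightarrow> r [^] n \<otimes> \<phi> e \<in> J"
      using T unfolding ext_torsion_def by blast
    show "\<exists>n::nat. \<forall>\<phi>\<in>UNIV \<rightarrow> carrier R. (\<forall>z\<in>syz R M 0. dot z \<phi> \<in> J1) \<longrightarrow>
       (\<forall>x\<in>base 0. r [^] n \<otimes> \<phi> x \<in> J1)"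
    \<comment> \<open>\<open>m\<close> corrects \<phi> to a cocycle modulo \<open>J\<close>, and
      \<open>n\<close> kills the corrected cocycle. The correction is a multiple of
      \<open>x\<close>, hence invisible modulo \<open>J1\<close>; the same count serves in higher
      degrees.\<close>
    proof (intro exI[of _ "n + m"] ballI impI)
      fix \<phi> :: "('a, 'c) label \<Rightarrow> 'a" and e
      assume \<phi>: "\<phi> \<in> UNIV \<rightarrow> carrier R" and co: "\<forall>z\<in>syz R M 0. dot z \<phi> \<in> J1" and e: "e \<in> base 0"
      from mp[OF bspec[OF m \<phi>] co] obtain \<theta> where \<theta>: "\<theta> \<in> UNIV \<rightarrow> carrier R"
        "\<forall>z\<in>syz R M 0. dot z (\<lambda>e. r [^] m \<otimes> \<phi> e \<ominus> x \<otimes> \<theta> e) \<in> J" by blast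
      have ec: "\<phi> e \<in> carrier R" "\<theta> e \<in> carrier R" using \<phi> \<theta>(1) by auto
      have "r [^] n \<otimes> (r [^] m \<otimes> \<phi> e \<ominus> x \<otimes> \<theta> e) \<in> J1"
        using n[OF c[OF \<phi> \<theta>(1)] \<theta>(2) e] I1(2) by blast
      hence "r [^] n \<otimes> (r [^] m \<otimes> \<phi> e \<ominus> x \<otimes> \<theta> e) \<ominus> \<zero> \<in> J1"
        using ec rc x by (simp add: a_minus_def)
      hence "r [^] n \<otimes> (r [^] m \<otimes> \<phi> e) \<ominus> \<zero> \<in> J1"
        by (rule ideal_minus_absorb[OF I1(1) rc _ R.zero_closed ec(2) I1(3), rotated]) (simp add: ec rc)
      thus "r [^] (n + m) \<otimes> \<phi> e \<in> J1"
        unfolding pw[OF ec(1)] using ec rc by (simp add: a_minus_def)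
    qed
  next
    fix i
    obtain m :: nat where m: "\<forall>\<phi>\<in>UNIV \<rightarrow> carrier R. (\<forall>z\<in>syz R M (Suc i). dot z \<phi> \<in> J1) \<longrightarrow>
      (\<exists>\<theta>\<in>UNIV \<rightarrow> carrier R. \<forall>z\<in>syz R M (Suc i). dot z (\<lambda>e. r [^] m \<otimes> \<phi> e \<ominus> x \<otimes> \<theta> e) \<in> J)"
      using lift[where k = "Suc i"] by (rule exE)
    obtain n :: nat where n: "\<And>\<phi>. \<phi> \<in> UNIV \<rightarrow> carrier R \<Longrightarrow> (\<forall>z\<in>syz R M (Suc i). dot z \<phi> \<in> J) \<Longrightarrow>
       (\<exists>\<psi>\<in>UNIV \<rightarrow> carrier R. \<forall>z\<in>syz R M i. r [^] n \<otimes> \<phi> (rel_label R z) \<ominus> dot z \<psi> \<in> J)"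
      using T unfolding ext_torsion_def by meson
    show "\<exists>n::nat. \<forall>\<phi>\<in>UNIV \<rightarrow> carrier R. (\<forall>z\<in>syz R M (Suc i). dot z \<phi> \<in> J1) \<longrightarrow>
       (\<exists>\<psi>\<in>UNIV \<rightarrow> carrier R. \<forall>z\<in>syz R M i. r [^] n \<otimes> \<phi> (rel_label R z) \<ominus> dot z \<psi> \<in> J1)"
    proof (intro exI[of _ "n + m"] ballI impI)
      fix \<phi> :: "('a, 'c) label \<Rightarrow> 'a"
      assume \<phi>: "\<phi> \<in> UNIV \<rightarrow> carrier R" and co: "\<forall>z\<in>syz R M (Suc i). dot z \<phi> \<in> J1"
      from mp[OF bspec[OF m \<phi>] co] obtain \<theta> where \<theta>: "\<theta> \<in> UNIV \<rightarrow> carrier R"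
        "\<forall>z\<in>syz R M (Suc i). dot z (\<lambda>e. r [^] m \<otimes> \<phi> e \<ominus> x \<otimes> \<theta> e) \<in> J" by blast
      from n[OF c[OF \<phi> \<theta>(1)] \<theta>(2)] obtain \<psi> where \<psi>: "\<psi> \<in> UNIV \<rightarrow> carrier R"
        "\<forall>z\<in>syz R M i. r [^] n \<otimes> (r [^] m \<otimes> \<phi> (rel_label R z) \<ominus> x \<otimes> \<theta> (rel_label R z)) \<ominus> dot z \<psi> \<in> J"
        by blast
      have "r [^] (n + m) \<otimes> \<phi> (rel_label R z) \<ominus> dot z \<psi> \<in> J1" if z: "z \<in> syz R M i" for z
      proof -
        let ?e = "rel_label R z"
        have ec: "\<phi> ?e \<in> carrier R" "\<theta> ?e \<in> carrier R" using \<phi> \<theta>(1) by auto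
        have dc: "dot z \<psi> \<in> carrier R" using z syz_finsupp \<psi>(1) by (blast intro: dot_closed)
        have "r [^] n \<otimes> (r [^] m \<otimes> \<phi> ?e \<ominus> x \<otimes> \<theta> ?e) \<ominus> dot z \<psi> \<in> J1"
          using \<psi>(2) z I1(2) by blast
        thus ?thesis unfolding pw[OF ec(1)]
          by (rule ideal_minus_absorb[OF I1(1) rc _ dc ec(2) I1(3), rotated]) (simp add: ec rc)
      qed
      thus "\<exists>\<psi>\<in>UNIV \<rightarrow> carrier R. \<forall>z\<in>syz R M i. r [^] (n + m) \<otimes> \<phi> (rel_label R z) \<ominus> dot z \<psi> \<in> J1"
        using \<psi>(1) by blast
    qed
  qed
qed

end

section \<open>Homomorphisms to the residue domain of a prime\<close>

context module
begin

text \<open>Recursion along a list of generators, because the induction over them drops one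
  generator at a time.\<close>

primrec span :: "'c list \<Rightarrow> 'c set" where
  "span [] = {\<zero>\<^bsub>M\<^esub>}"
| "span (g # gs) = {c \<odot>\<^bsub>M\<^esub> g \<oplus>\<^bsub>M\<^esub> y |c y. c \<in> carrier R \<and> y \<in> span gs}"

lemma span_subset: "set gs \<subseteq> carrier M \<Longrightarrow> span gs \<subseteq> carrier M"
  by (induction gs) auto

lemma span_closed:
  assumes "set gs \<subseteq> carrier M" 
  shows "x \<in> span gs \<Longrightarrow> a \<in> carrier R \<Longrightarrow> a \<odot>\<^bsub>M\<^esub> x \<in> span gs"
    and "x \<in> span gs \<Longrightarrow> y \<in> span gs \<Longrightarrow> x \<oplus>\<^bsub>M\<^esub> y \<in> span gs"
    and "\<zero>\<^bsub>M\<^esub> \<in> span gs"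
proof -
  have "(x \<in> span gs \<longrightarrow> a \<in> carrier R \<longrightarrow> a \<odot>\<^bsub>M\<^esub> x \<in> span gs) \<and>
    (x \<in> span gs \<longrightarrow> y \<in> span gs \<longrightarrow> x \<oplus>\<^bsub>M\<^esub> y \<in> span gs) \<and> \<zero>\<^bsub>M\<^esub> \<in> span gs" for x y a
    using assms
  proof (induction gs arbitrary: x y)
    case (Cons g gs)
    hence g: "g \<in> carrier M" and gs: "set gs \<subseteq> carrier M" by auto
    note IH = Cons.IH[OF gs]
    have sc: "y \<in> carrier M" if "y \<in> span gs" for y using span_subset[OF gs] that by blast
    show ?case
    proof (intro conjI impI)
      assume "x \<in> span (g # gs)" and a: "a \<in> carrier R"
      then obtain c u where cu: "c \<in> carrier R" "u \<in> span gs" "x = c \<odot>\<^bsub>M\<^esub> g \<oplus>\<^bsub>M\<^esub> u" by auto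
      hence "a \<odot>\<^bsub>M\<^esub> x = (a \<otimes> c) \<odot>\<^bsub>M\<^esub> g \<oplus>\<^bsub>M\<^esub> a \<odot>\<^bsub>M\<^esub> u"
        using a g sc by (simp add: smult_r_distr smult_assoc1)
      moreover have "a \<odot>\<^bsub>M\<^esub> u \<in> span gs" using IH cu a by blast
      ultimately show "a \<odot>\<^bsub>M\<^esub> x \<in> span (g # gs)" using a cu by auto
    next
      assume "x \<in> span (g # gs)" "y \<in> span (g # gs)"
      then obtain c u d v where cu: "c \<in> carrier R" "u \<in> span gs" "x = c \<odot>\<^bsub>M\<^esub> g \<oplus>\<^bsub>M\<^esub> u"
        "d \<in> carrier R" "v \<in> span gs" "y = d \<odot>\<^bsub>M\<^esub> g \<oplus>\<^bsub>M\<^esub> v" by auto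
      hence "x \<oplus>\<^bsub>M\<^esub> y = (c \<oplus> d) \<odot>\<^bsub>M\<^esub> g \<oplus>\<^bsub>M\<^esub> (u \<oplus>\<^bsub>M\<^esub> v)"
        using g sc by (simp add: smult_l_distr M.a_ac)
      moreover have "u \<oplus>\<^bsub>M\<^esub> v \<in> span gs" using IH cu by blast
      ultimately show "x \<oplus>\<^bsub>M\<^esub> y \<in> span (g # gs)" using cu by auto
    next
      have "\<zero>\<^bsub>M\<^esub> = \<zero> \<odot>\<^bsub>M\<^esub> g \<oplus>\<^bsub>M\<^esub> \<zero>\<^bsub>M\<^esub>" using g by simp
      moreover have "\<zero>\<^bsub>M\<^esub> \<in> span gs" using IH by blast
      ultimately show "\<zero>\<^bsub>M\<^esub> \<in> span (g # gs)" unfolding span.simps using R.zero_closed by blast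
    qed
  qed auto
  thus "x \<in> span gs \<Longrightarrow> a \<in> carrier R \<Longrightarrow> a \<odot>\<^bsub>M\<^esub> x \<in> span gs"
    "x \<in> span gs \<Longrightarrow> y \<in> span gs \<Longrightarrow> x \<oplus>\<^bsub>M\<^esub> y \<in> span gs"
    "\<zero>\<^bsub>M\<^esub> \<in> span gs" by blast+
qed

lemma finitely_generated_span:
  assumes "finitely_generated R M"
  shows "\<exists>gs. set gs \<subseteq> carrier M \<and> carrier M \<subseteq> span gs"
proof -
  obtain A where A: "finite A" "A \<subseteq> carrier M"
    "\<And>x. x \<in> carrier M \<Longrightarrow> \<exists>c\<in>A \<rightarrow> carrier R. x = (\<Oplus>\<^bsub>M\<^esub>a\<in>A. c a \<odot>\<^bsub>M\<^esub> a)"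
    using assms unfolding finitely_generated_def by blast
  obtain gs where gs: "set gs = A" "distinct gs" using finite_distinct_list[OF A(1)] by blast
  have "(\<Oplus>\<^bsub>M\<^esub>a\<in>set gs. c a \<odot>\<^bsub>M\<^esub> a) \<in> span gs"
    if "distinct gs" "set gs \<subseteq> carrier M" "c \<in> set gs \<rightarrow> carrier R" for c gs
    using that
  proof (induction gs)
    case (Cons g gs)
    have "(\<Oplus>\<^bsub>M\<^esub>a\<in>insert g (set gs). c a \<odot>\<^bsub>M\<^esub> a) = c g \<odot>\<^bsub>M\<^esub> g \<oplus>\<^bsub>M\<^esub> (\<Oplus>\<^bsub>M\<^esub>a\<in>set gs. c a \<odot>\<^bsub>M\<^esub> a)"
      using Cons.prems by (intro M.finsum_insert) (auto simp: Pi_iff)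
    thus ?case using Cons by auto
  qed simp
  thus ?thesis using A(3) A(2) gs by (intro exI[of _ gs]) blast
qed

text \<open>A homomorphism from M to R/P, represented by lifts of its values to R.\<close>

definition linear_mod :: "'a set \<Rightarrow> ('c \<Rightarrow> 'a) \<Rightarrow> bool" where
  "linear_mod P \<phi> \<longleftrightarrow> \<phi> \<in> carrier M \<rightarrow> carrier R \<and>
    (\<forall>x\<in>carrier M. \<forall>y\<in>carrier M. \<phi> x \<oplus> \<phi> y \<ominus> \<phi> (x \<oplus>\<^bsub>M\<^esub> y) \<in> P) \<and>
    (\<forall>a\<in>carrier R. \<forall>x\<in>carrier M. a \<otimes> \<phi> x \<ominus> \<phi> (a \<odot>\<^bsub>M\<^esub> x) \<in> P)"

text \<open>If \<open>s \<notin> P\<close> multiplies \<open>M\<close> into the span of \<open>g # gs\<close>, either some \<open>t \<notin> P\<close> multiplies \<open>g\<close> into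
  the span of \<open>gs\<close>, and \<open>g\<close> can be dropped, or the coefficient of \<open>g\<close> in \<open>s \<odot> x\<close> is well defined modulo \<open>P\<close>.\<close>

lemma ex_nonzero_linear_mod_prime_aux:
  assumes P: "primeideal P R" and ann: "annihilator R M \<subseteq> P"
  shows "set gs \<subseteq> carrier M \<Longrightarrow> s \<in> carrier R - P \<Longrightarrow> (\<And>x. x \<in> carrier M \<Longrightarrow> s \<odot>\<^bsub>M\<^esub> x \<in> span gs) \<Longrightarrow>
    \<exists>\<phi>. linear_mod P \<phi> \<and> (\<exists>m\<in>carrier M. \<phi> m \<notin> P)"
proof (induction gs arbitrary: s)
  case Nil
  hence "s \<in> annihilator R M" by (auto simp: annihilator_def)
  thus ?case using ann Nil by blast
next
  case (Cons g gs)
  have I: "ideal P R" using P by (rule primeideal.axioms)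
  have g: "g \<in> carrier M" and gs: "set gs \<subseteq> carrier M" and s: "s \<in> carrier R" "s \<notin> P" using Cons.prems by auto
  have sc: "y \<in> carrier M" if "y \<in> span gs" for y using span_subset[OF gs] that by blast
  show ?case
  proof (cases "\<exists>t\<in>carrier R - P. t \<odot>\<^bsub>M\<^esub> g \<in> span gs")
    case True
    then obtain t where t: "t \<in> carrier R" "t \<notin> P" "t \<odot>\<^bsub>M\<^esub> g \<in> span gs" by blast
    show ?thesis
    proof (rule Cons.IH[OF gs])
      show "t \<otimes> s \<in> carrier R - P" using primeideal.I_prime[OF P t(1) s(1)] t s by blast
      fix x assume x: "x \<in> carrier M"
      then obtain c y where cy: "c \<in> carrier R" "y \<in> span gs" "s \<odot>\<^bsub>M\<^esub> x = c \<odot>\<^bsub>M\<^esub> g \<oplus>\<^bsub>M\<^esub> y"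
        using Cons.prems(3)[OF x] by auto
      have "(t \<otimes> s) \<odot>\<^bsub>M\<^esub> x = t \<odot>\<^bsub>M\<^esub> (c \<odot>\<^bsub>M\<^esub> g \<oplus>\<^bsub>M\<^esub> y)"
        using smult_assoc1[OF t(1) s(1) x] cy by simp
      also have "\<dots> = c \<odot>\<^bsub>M\<^esub> (t \<odot>\<^bsub>M\<^esub> g) \<oplus>\<^bsub>M\<^esub> t \<odot>\<^bsub>M\<^esub> y"
        using t cy g sc by (simp add: smult_r_distr smult_assoc1[symmetric] R.m_comm)
      finally show "(t \<otimes> s) \<odot>\<^bsub>M\<^esub> x \<in> span gs" using span_closed[OF gs] t cy by simp
    qed
  next
    case False
    define Q where "Q x c \<longleftrightarrow> c \<in> carrier R \<and> (\<exists>y\<in>span gs. s \<odot>\<^bsub>M\<^esub> x = c \<odot>\<^bsub>M\<^esub> g \<oplus>\<^bsub>M\<^esub> y)" for x c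
    have unique: "c \<ominus> d \<in> P" if "Q x c" "Q x d" for x c d
    proof -
      \<comment> \<open>Two coefficients of \<open>g\<close> for the same \<open>x\<close> differ by
        an element that multiplies \<open>g\<close> into the span of \<open>gs\<close>; in the
        present case such elements lie in \<open>P\<close>.\<close>
      obtain u v where uv: "c \<in> carrier R" "d \<in> carrier R" "u \<in> span gs" "v \<in> span gs"
        "c \<odot>\<^bsub>M\<^esub> g \<oplus>\<^bsub>M\<^esub> u = d \<odot>\<^bsub>M\<^esub> g \<oplus>\<^bsub>M\<^esub> v" using \<open>Q x c\<close> \<open>Q x d\<close> unfolding Q_def by metis
      define A B where "A = c \<odot>\<^bsub>M\<^esub> g" and "B = d \<odot>\<^bsub>M\<^esub> g"
      have AB: "A \<in> carrier M" "B \<in> carrier M" "u \<in> carrier M" "v \<in> carrier M"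
        using uv g sc by (simp_all add: A_def B_def)
      have "(c \<ominus> d) \<odot>\<^bsub>M\<^esub> g = A \<oplus>\<^bsub>M\<^esub> \<ominus>\<^bsub>M\<^esub> B"
        using uv g by (simp add: a_minus_def smult_l_distr smult_l_minus A_def B_def)
      also have "\<dots> = (A \<oplus>\<^bsub>M\<^esub> u) \<oplus>\<^bsub>M\<^esub> (\<ominus>\<^bsub>M\<^esub> u \<oplus>\<^bsub>M\<^esub> \<ominus>\<^bsub>M\<^esub> B)"
        using AB by (simp add: M.a_assoc M.r_neg2)
      also have "A \<oplus>\<^bsub>M\<^esub> u = B \<oplus>\<^bsub>M\<^esub> v" using uv(5) by (simp add: A_def B_def)
      also have "(B \<oplus>\<^bsub>M\<^esub> v) \<oplus>\<^bsub>M\<^esub> (\<ominus>\<^bsub>M\<^esub> u \<oplus>\<^bsub>M\<^esub> \<ominus>\<^bsub>M\<^esub> B)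
          = (v \<oplus>\<^bsub>M\<^esub> \<ominus>\<^bsub>M\<^esub> u) \<oplus>\<^bsub>M\<^esub> (B \<oplus>\<^bsub>M\<^esub> \<ominus>\<^bsub>M\<^esub> B)"
        using AB by (simp add: M.a_ac)
      also have "\<dots> = v \<oplus>\<^bsub>M\<^esub> (\<ominus> \<one>) \<odot>\<^bsub>M\<^esub> u"
        using AB by (simp add: M.r_neg smult_l_minus)
      also have "\<dots> \<in> span gs" using span_closed[OF gs] uv by simp
      finally show ?thesis using False uv by (metis DiffI R.minus_closed)
    qed
    have "\<exists>c. Q x c" if "x \<in> carrier M" for x
      using Cons.prems(3)[OF that] unfolding Q_def by auto
    then obtain \<phi> where \<phi>: "\<And>x. x \<in> carrier M \<Longrightarrow> Q x (\<phi> x)" by metis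
    have "linear_mod P \<phi>"
      unfolding linear_mod_def
    proof (intro conjI ballI)
      show "\<phi> \<in> carrier M \<rightarrow> carrier R" using \<phi> by (auto simp: Q_def)
    next
      fix x y assume x: "x \<in> carrier M" and y: "y \<in> carrier M"
      obtain u v where uv: "\<phi> x \<in> carrier R" "u \<in> span gs" "s \<odot>\<^bsub>M\<^esub> x = \<phi> x \<odot>\<^bsub>M\<^esub> g \<oplus>\<^bsub>M\<^esub> u"
        "\<phi> y \<in> carrier R" "v \<in> span gs" "s \<odot>\<^bsub>M\<^esub> y = \<phi> y \<odot>\<^bsub>M\<^esub> g \<oplus>\<^bsub>M\<^esub> v"
        using \<phi>[OF x] \<phi>[OF y] unfolding Q_def by blast
      have "s \<odot>\<^bsub>M\<^esub> (x \<oplus>\<^bsub>M\<^esub> y) = (\<phi> x \<oplus> \<phi> y) \<odot>\<^bsub>M\<^esub> g \<oplus>\<^bsub>M\<^esub> (u \<oplus>\<^bsub>M\<^esub> v)"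
        using x y s uv sc g by (simp add: smult_r_distr smult_l_distr M.a_ac)
      hence "Q (x \<oplus>\<^bsub>M\<^esub> y) (\<phi> x \<oplus> \<phi> y)"
        unfolding Q_def using uv span_closed(2)[OF gs] by blast
      thus "\<phi> x \<oplus> \<phi> y \<ominus> \<phi> (x \<oplus>\<^bsub>M\<^esub> y) \<in> P" using unique \<phi> x y by blast
    next
      fix a x assume a: "a \<in> carrier R" and x: "x \<in> carrier M"
      obtain u where u: "\<phi> x \<in> carrier R" "u \<in> span gs" "s \<odot>\<^bsub>M\<^esub> x = \<phi> x \<odot>\<^bsub>M\<^esub> g \<oplus>\<^bsub>M\<^esub> u"
        using \<phi>[OF x] unfolding Q_def by blast
      have "s \<odot>\<^bsub>M\<^esub> (a \<odot>\<^bsub>M\<^esub> x) = a \<odot>\<^bsub>M\<^esub> (s \<odot>\<^bsub>M\<^esub> x)"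
        using a x s by (simp add: smult_assoc1[symmetric] R.m_comm)
      also have "\<dots> = (a \<otimes> \<phi> x) \<odot>\<^bsub>M\<^esub> g \<oplus>\<^bsub>M\<^esub> a \<odot>\<^bsub>M\<^esub> u"
        unfolding u(3) using a u sc g by (simp add: smult_r_distr smult_assoc1)
      finally have "Q (a \<odot>\<^bsub>M\<^esub> x) (a \<otimes> \<phi> x)"
        unfolding Q_def using u a span_closed(1)[OF gs] by blast
      thus "a \<otimes> \<phi> x \<ominus> \<phi> (a \<odot>\<^bsub>M\<^esub> x) \<in> P" using unique \<phi> a x by blast
    qed
    moreover have "\<phi> g \<notin> P"
    proof
      \<comment> \<open>At \<open>g\<close> itself the coefficient may be taken to be
        \<open>s\<close>, so the value of \<phi> is congruent to \<open>s\<close> and not in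
        \<open>P\<close>.\<close>
      have "s \<odot>\<^bsub>M\<^esub> g = s \<odot>\<^bsub>M\<^esub> g \<oplus>\<^bsub>M\<^esub> \<zero>\<^bsub>M\<^esub>" using s g by simp
      hence "Q g s" unfolding Q_def using s span_closed(3)[OF gs] by blast
      hence "s \<ominus> \<phi> g \<in> P" using unique \<phi>[OF g] by blast
      moreover assume "\<phi> g \<in> P"
      ultimately show False using ideal_minus_mem[OF I, of s "\<phi> g"] s \<phi>[OF g] by (simp add: Q_def)
    qed
    ultimately show ?thesis using g by blast
  qed
qed

text \<open>In local terms, M_P is nonzero, so some nonzero cyclic quotient of it maps onto the
  residue field of R_P. The multiplier \<open>s\<close> above is the common denominator; the descent
  starts with denominator one and a full list of generators.\<close>

lemma ex_nonzero_linear_mod_prime: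
  assumes P: "primeideal P R" and ann: "annihilator R M \<subseteq> P" and fg: "finitely_generated R M"
  shows "\<exists>\<phi>. linear_mod P \<phi> \<and> (\<exists>m\<in>carrier M. \<phi> m \<notin> P)"
proof -
  obtain gs where gs: "set gs \<subseteq> carrier M" "carrier M \<subseteq> span gs" using finitely_generated_span[OF fg] by blast
  have I: "ideal P R" using P by (rule primeideal.axioms)
  have "\<one> \<notin> P" using ideal.one_imp_carrier[OF I] primeideal.I_notcarr[OF P] by blast
  hence "\<one> \<in> carrier R - P" by simp
  from ex_nonzero_linear_mod_prime_aux[OF P ann gs(1) this] gs(2) show ?thesis
    by (simp add: subset_iff)
qed

section \<open>Degree-zero cocycles from homomorphisms modulo an ideal\<close>

lemma linear_mod_finsum:
  assumes \<phi>: "linear_mod P \<phi>" and I: "ideal P R" and S: "finite S" "S \<subseteq> carrier M" and c: "\<And>x. c x \<in> carrier R"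
  shows "(\<Oplus>x\<in>S. c x \<otimes> \<phi> x) \<ominus> \<phi> (\<Oplus>\<^bsub>M\<^esub>x\<in>S. c x \<odot>\<^bsub>M\<^esub> x) \<in> P"
proof -
  have \<phi>c: "\<phi> x \<in> carrier R" if "x \<in> carrier M" for x using \<phi> that by (auto simp: linear_mod_def)
  show ?thesis using S
  proof (induction S rule: finite_induct)
    case empty
    have "\<zero> \<otimes> \<phi> \<zero>\<^bsub>M\<^esub> \<ominus> \<phi> (\<zero> \<odot>\<^bsub>M\<^esub> \<zero>\<^bsub>M\<^esub>) \<in> P"
      using \<phi> unfolding linear_mod_def by blast
    thus ?case using \<phi>c by simp
  next
    case (insert s S)
    let ?x = "\<Oplus>\<^bsub>M\<^esub>x\<in>S. c x \<odot>\<^bsub>M\<^esub> x"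
    let ?r = "\<Oplus>x\<in>S. c x \<otimes> \<phi> x"
    have s: "s \<in> carrier M" and S: "S \<subseteq> carrier M" using insert by auto
    have x: "?x \<in> carrier M" using S c by (intro M.finsum_closed) auto
    have r: "?r \<in> carrier R" using S c \<phi>c by (intro R.finsum_closed) auto
    have "(c s \<otimes> \<phi> s \<oplus> ?r) \<ominus> (\<phi> (c s \<odot>\<^bsub>M\<^esub> s) \<oplus> \<phi> ?x) \<in> P"
      using \<phi> c s insert.IH[OF S] \<phi>c x r
      by (intro ideal_minus_add[OF I]) (auto simp: linear_mod_def)
    moreover have "\<phi> (c s \<odot>\<^bsub>M\<^esub> s) \<oplus> \<phi> ?x \<ominus> \<phi> (c s \<odot>\<^bsub>M\<^esub> s \<oplus>\<^bsub>M\<^esub> ?x) \<in> P"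
      using \<phi> c s x unfolding linear_mod_def by simp
    ultimately have "(c s \<otimes> \<phi> s \<oplus> ?r) \<ominus> \<phi> (c s \<odot>\<^bsub>M\<^esub> s \<oplus>\<^bsub>M\<^esub> ?x) \<in> P"
      using ideal_minus_trans[OF I] c s r x \<phi>c by simp
    moreover have "(\<Oplus>x\<in>insert s S. c x \<otimes> \<phi> x) = c s \<otimes> \<phi> s \<oplus> ?r"
      using insert S c \<phi>c s by (intro R.finsum_insert) auto
    moreover have "(\<Oplus>\<^bsub>M\<^esub>x\<in>insert s S. c x \<odot>\<^bsub>M\<^esub> x) = c s \<odot>\<^bsub>M\<^esub> s \<oplus>\<^bsub>M\<^esub> ?x"
      using insert S c s by (intro M.finsum_insert) auto
    ultimately show ?case by simp
  qed
qed

definition on_gens :: "('c \<Rightarrow> 'a) \<Rightarrow> ('a, 'c) label \<Rightarrow> 'a" where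
  "on_gens \<phi> l = (case l of Gen m \<Rightarrow> if m \<in> carrier M then \<phi> m else \<zero> | Rel S \<Rightarrow> \<zero>)"

text \<open>A relation among elements of M is carried by \<phi> to a congruence modulo
  \<open>P\<close>. The value of \<phi> at zero is itself only known to lie in \<open>P\<close>,
  which suffices.\<close>

lemma dot_on_gens_mem:
  assumes \<phi>: "linear_mod P \<phi>" and I: "ideal P R" and z: "z \<in> syz R M 0"
  shows "dot z (on_gens \<phi>) \<in> P"
proof -
  let ?S = "{m \<in> carrier M. z (Gen m) \<noteq> \<zero>}"
  have zf: "z \<in> finsupp" and zb: "{x. z x \<noteq> \<zero>} \<subseteq> base 0" and z0: "aug z = \<zero>\<^bsub>M\<^esub>"
    using z unfolding syz_0_iff by blast+
  have \<phi>c: "\<phi> x \<in> carrier R" if "x \<in> carrier M" for x using \<phi> that by (auto simp: linear_mod_def)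
  have im: "{x. z x \<noteq> \<zero>} = Gen ` ?S" using zb by auto
  have "dot z (on_gens \<phi>) = (\<Oplus>m\<in>?S. z (Gen m) \<otimes> on_gens \<phi> (Gen m))"
    unfolding dot_def im
    by (intro R.finsum_reindex) (auto simp: inj_on_def on_gens_def finsupp_closed[OF zf] \<phi>c)
  also have "\<dots> = (\<Oplus>m\<in>?S. z (Gen m) \<otimes> \<phi> m)"
    by (intro R.finsum_cong') (auto simp: on_gens_def finsupp_closed[OF zf] \<phi>c)
  finally have eq: "dot z (on_gens \<phi>) = (\<Oplus>m\<in>?S. z (Gen m) \<otimes> \<phi> m)" .
  have "(\<Oplus>m\<in>?S. z (Gen m) \<otimes> \<phi> m) \<ominus> \<phi> (\<Oplus>\<^bsub>M\<^esub>m\<in>?S. z (Gen m) \<odot>\<^bsub>M\<^esub> m) \<in> P"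
    by (rule linear_mod_finsum[OF \<phi> I finite_gens[OF zf]]) (auto simp: finsupp_closed[OF zf])
  also have "(\<Oplus>\<^bsub>M\<^esub>m\<in>?S. z (Gen m) \<odot>\<^bsub>M\<^esub> m) = \<zero>\<^bsub>M\<^esub>" using z0 by (simp add: aug_def lin_ext_def)
  finally have 1: "dot z (on_gens \<phi>) \<ominus> \<phi> \<zero>\<^bsub>M\<^esub> \<in> P" unfolding eq .
  have "\<zero> \<otimes> \<phi> \<zero>\<^bsub>M\<^esub> \<ominus> \<phi> (\<zero> \<odot>\<^bsub>M\<^esub> \<zero>\<^bsub>M\<^esub>) \<in> P" using \<phi> unfolding linear_mod_def by blast
  hence "\<zero> \<ominus> \<phi> \<zero>\<^bsub>M\<^esub> \<in> P" using \<phi>c by simp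
  moreover have "\<zero> \<in> P" using additive_subgroup.zero_closed[OF ideal.axioms(1)[OF I]] .
  ultimately have "\<phi> \<zero>\<^bsub>M\<^esub> \<in> P" using ideal_minus_mem[OF I, of \<zero> "\<phi> \<zero>\<^bsub>M\<^esub>"] \<phi>c by simp
  moreover have "dot z (on_gens \<phi>) \<in> carrier R"
    using zf by (intro dot_closed) (auto simp: on_gens_def \<phi>c split: label.split)
  ultimately show ?thesis using ideal_minus_mem[OF I 1] \<phi>c by simp
qed

section \<open>Ext-torsion forces torsion\<close>

lemma ideal_annihilator: "ideal (annihilator R M) R"
proof (rule idealI)
  show "subgroup (annihilator R M) (add_monoid R)"
  proof (rule R.add.subgroupI)
    show "annihilator R M \<noteq> {}"
      by (auto simp: annihilator_def intro!: exI[of _ \<zero>])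
  qed (auto simp: annihilator_def smult_l_distr smult_l_minus)
  show "ring R" by (rule R.ring_axioms)
next
  fix a x assume a: "a \<in> annihilator R M" and x: "x \<in> carrier R"
  have aR: "a \<in> carrier R" "\<And>m. m \<in> carrier M \<Longrightarrow> a \<odot>\<^bsub>M\<^esub> m = \<zero>\<^bsub>M\<^esub>"
    using a by (auto simp: annihilator_def)
  thus "x \<otimes> a \<in> annihilator R M" using x by (simp add: annihilator_def smult_assoc1)
  thus "a \<otimes> x \<in> annihilator R M" using R.m_comm[OF aR(1) x] by simp
qed

lemma ext_torsion_imp_power_annihilates:
  assumes noeth: "noetherian_ring R" and fg: "finitely_generated R M" and r: "r \<in> carrier R"
    and T: "ext_torsion r {\<zero>}"
  shows "\<exists>n::nat. r [^] n \<in> annihilator R M"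
proof -
  let ?A = "annihilator R M"
  have rc: "r [^] n \<in> carrier R" for n :: nat using r by simp
  define \<S> where "\<S> = {J. ideal J R \<and> J \<subseteq> ?A \<and> ext_torsion r J}"
  have "{\<zero>} \<in> \<S>"
    using T R.zeroideal additive_subgroup.zero_closed[OF ideal.axioms(1)[OF ideal_annihilator]]
    by (simp add: \<S>_def)
  hence "\<exists>J\<in>\<S>. \<forall>K\<in>\<S>. J \<subseteq> K \<longrightarrow> K = J"
    by (intro noetherian_ring.ex_maximal_ideal[OF noeth]) (auto simp: \<S>_def)
  then obtain J where J: "ideal J R" "J \<subseteq> ?A" "ext_torsion r J"
    and max: "\<And>K. K \<in> \<S> \<Longrightarrow> J \<subseteq> K \<Longrightarrow> K = J" by (auto simp: \<S>_def)
  \<comment> \<open>The ideals of elements multiplied into \<open>J\<close> by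
    \<open>r [^] n\<close> increase with n. One that is maximal, with exponent \<open>N\<close>, is
    the r-saturation \<open>Jh\<close>.\<close>
  have "\<exists>K\<in>range (\<lambda>n::nat. colon R J (r [^] n)). \<forall>L\<in>range (\<lambda>n::nat. colon R J (r [^] n)). K \<subseteq> L \<longrightarrow> L = K"
    by (intro noetherian_ring.ex_maximal_ideal[OF noeth]) (auto intro: ideal_colon[OF J(1) rc])
  then obtain N :: nat where N: "\<And>n::nat. colon R J (r [^] N) \<subseteq> colon R J (r [^] n) \<Longrightarrow>
      colon R J (r [^] n) = colon R J (r [^] N)" by auto
  define Jh where "Jh = colon R J (r [^] N)"
  have mem_Jh: "y \<in> Jh \<longleftrightarrow> y \<in> carrier R \<and> r [^] N \<otimes> y \<in> J" for y
    using R.m_comm[OF rc, of y N] by (auto simp: Jh_def colon_def)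
  have IJh: "ideal Jh R" unfolding Jh_def by (rule ideal_colon[OF J(1) rc])
  have J_Jh: "J \<subseteq> Jh"
    using ideal.I_l_closed[OF J(1) _ rc] ideal.Icarr[OF J(1)] by (auto simp: mem_Jh)
  have sat1: "y \<in> Jh" if "y \<in> carrier R" "r \<otimes> y \<in> Jh" for y
  proof -
    have eq: "z \<otimes> r [^] Suc N = r \<otimes> (z \<otimes> r [^] N)" if "z \<in> carrier R" for z
      using that r rc R.m_lcomm[of r z "r [^] N"] R.m_comm[of r "r [^] N"] by simp
    have "colon R J (r [^] N) \<subseteq> colon R J (r [^] Suc N)"
    proof
      fix z assume "z \<in> colon R J (r [^] N)"
      hence "z \<in> carrier R" "z \<otimes> r [^] N \<in> J" by (auto simp: colon_def)
      thus "z \<in> colon R J (r [^] Suc N)"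
        using ideal.I_l_closed[OF J(1) _ r] eq[of z] by (simp add: colon_def del: nat_pow_Suc)
    qed
    hence "Jh = colon R J (r [^] Suc N)" unfolding Jh_def by (rule N[symmetric])
    moreover have "y \<in> colon R J (r [^] Suc N)"
      using that eq[of y] r rc by (simp add: Jh_def colon_def R.m_assoc del: nat_pow_Suc)
    ultimately show ?thesis by simp
  qed
  have sat: "y \<in> Jh" if "y \<in> carrier R" "r [^] n \<otimes> y \<in> Jh" for y and n :: nat
    using that
  proof (induction n)
    case (Suc n)
    hence "r \<otimes> (r [^] n \<otimes> y) \<in> Jh"
      using r rc R.m_comm[of r "r [^] n"] by (simp add: R.m_assoc[symmetric])
    thus ?case using sat1 Suc rc by simp
  qed simp
  from R.ex_regular_or_associated_prime[OF noeth IJh ideal_annihilator] show ?thesis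
  proof
    assume "\<exists>x\<in>?A. colon R Jh x = Jh"
    then obtain x where x: "x \<in> ?A" "colon R Jh x = Jh" by blast
    have xc: "x \<in> carrier R" using x by (simp add: annihilator_def)
    define J1 where "J1 = J <+>\<^bsub>R\<^esub> PIdl x"
    have IP: "ideal (PIdl x) R" by (rule R.cgenideal_ideal[OF xc])
    have I1: "ideal J1 R" unfolding J1_def by (rule R.add_ideals[OF J(1) IP])
    have J1: "w \<in> J1 \<longleftrightarrow> (\<exists>j\<in>J. \<exists>y\<in>carrier R. w = j \<oplus> y \<otimes> x)" for w
      by (auto simp: J1_def set_add_def' cgenideal_def)
    have J_J1: "J \<subseteq> J1"
    proof
      fix j assume "j \<in> J"
      moreover from this have "j = j \<oplus> \<zero> \<otimes> x" using ideal.Icarr[OF J(1)] xc by simp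
      ultimately show "j \<in> J1" unfolding J1 by blast
    qed
    have x_J1: "x \<in> J1"
    proof -
      have "x = \<zero> \<oplus> \<one> \<otimes> x" using xc by simp
      thus ?thesis unfolding J1
        using additive_subgroup.zero_closed[OF ideal.axioms(1)[OF J(1)]] by blast
    qed
    have "ext_torsion r J1"
    \<comment> \<open>Regularity modulo \<open>Jh\<close> reads modulo \<open>J\<close> as
      cancellation of \<open>x\<close> at the cost of \<open>r [^] N\<close>, the exponent that
      carries \<open>Jh\<close> into \<open>J\<close>.\<close>
    proof (rule ext_torsion_add_regular[OF J(3,1) r xc _ I1 J_J1 x_J1])
      fix y assume y: "y \<in> carrier R" and "x \<otimes> y \<in> J"
      hence "y \<in> colon R Jh x" using J_Jh R.m_comm[OF y xc] by (auto simp: colon_def)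
      thus "r [^] N \<otimes> y \<in> J" unfolding x(2) mem_Jh by blast
    next
      fix w assume "w \<in> J1"
      then obtain j y where w: "j \<in> J" "y \<in> carrier R" "w = j \<oplus> y \<otimes> x" unfolding J1 by blast
      have "j \<in> carrier R" using ideal.Icarr[OF J(1) w(1)] .
      hence "w \<ominus> x \<otimes> y = j" using w(2,3) xc by (simp add: a_minus_def R.a_assoc R.r_neg R.m_comm)
      thus "\<exists>y\<in>carrier R. w \<ominus> x \<otimes> y \<in> J" using w by blast
    qed
    moreover have "J1 \<subseteq> ?A"
    proof
      fix w assume "w \<in> J1"
      then obtain j y where w: "j \<in> J" "y \<in> carrier R" "w = j \<oplus> y \<otimes> x" unfolding J1 by blast
      show "w \<in> ?A" unfolding w(3)
        using additive_subgroup.a_closed[OF ideal.axioms(1)[OF ideal_annihilator]]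
          ideal.I_l_closed[OF ideal_annihilator x(1) w(2)] w(1) J(2) by blast
    qed
    ultimately have "J1 = J" using max I1 J_J1 by (simp add: \<S>_def)
    \<comment> \<open>Now \<open>x\<close> lies in \<open>Jh\<close> and is regular modulo
      \<open>Jh\<close>, which is possible only if \<open>Jh\<close> is the whole ring.\<close>
    hence "\<one> \<in> colon R Jh x" using x_J1 J_Jh xc by (auto simp: colon_def)
    hence "r [^] N \<in> J" unfolding x(2) mem_Jh using rc by simp
    thus ?thesis using J(2) by blast
  next
    assume "\<exists>b\<in>carrier R - Jh. primeideal (colon R Jh b) R \<and> ?A \<subseteq> colon R Jh b"
    then obtain b where b: "b \<in> carrier R" "b \<notin> Jh" and P: "primeideal (colon R Jh b) R" "?A \<subseteq> colon R Jh b"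
      by blast
    have IP: "ideal (colon R Jh b) R" using P(1) by (rule primeideal.axioms)
    obtain \<phi> m where \<phi>: "linear_mod (colon R Jh b) \<phi>" and m: "m \<in> carrier M" "\<phi> m \<notin> colon R Jh b"
      using ex_nonzero_linear_mod_prime[OF P fg] by blast
    have gc: "on_gens \<phi> \<in> UNIV \<rightarrow> carrier R"
      using \<phi> by (auto simp: on_gens_def linear_mod_def split: label.split)
    have \<phi>m: "\<phi> m \<in> carrier R" using \<phi> m by (auto simp: linear_mod_def)
    \<comment> \<open>The composite of three maps: \<phi> into R/P, multiplication by
      \<open>b\<close> from R/P to R/Jh, and multiplication by \<open>r [^] N\<close> from R/Jh to
      R/J. The last brings the cocycle back to \<open>J\<close>, where torsion is assumed.\<close>
    define \<psi> where "\<psi> = (\<lambda>l. r [^] N \<otimes> (b \<otimes> on_gens \<phi> l))"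
    have \<psi>c: "\<psi> \<in> UNIV \<rightarrow> carrier R" "(\<lambda>l. b \<otimes> on_gens \<phi> l) \<in> UNIV \<rightarrow> carrier R"
      using gc rc b by (auto simp: \<psi>_def)
    have "dot z \<psi> \<in> J" if z: "z \<in> syz R M 0" for z
    proof -
      have zf: "z \<in> finsupp" using z syz_finsupp by blast
      have dc: "dot z (on_gens \<phi>) \<in> carrier R" by (rule dot_closed[OF zf gc])
      have "b \<otimes> dot z (on_gens \<phi>) \<in> Jh"
        using dot_on_gens_mem[OF \<phi> IP z] R.m_comm[OF b(1) dc] by (simp add: colon_def)
      hence "r [^] N \<otimes> (b \<otimes> dot z (on_gens \<phi>)) \<in> J" by (simp add: mem_Jh)
      also have "r [^] N \<otimes> (b \<otimes> dot z (on_gens \<phi>)) = dot z \<psi>"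
        unfolding \<psi>_def dot_smult_right[OF zf \<psi>c(2) rc] dot_smult_right[OF zf gc b(1)] ..
      finally show ?thesis .
    qed
    moreover have "Gen m \<in> base 0" using m by simp
    ultimately obtain n :: nat where "r [^] n \<otimes> \<psi> (Gen m) \<in> J"
      using J(3) \<psi>c(1) unfolding ext_torsion_def by blast
    hence "r [^] n \<otimes> (r [^] N \<otimes> (b \<otimes> \<phi> m)) \<in> Jh"
      using J_Jh m(1) by (auto simp: \<psi>_def on_gens_def)
    \<comment> \<open>Saturation is used twice, to remove the power \<open>n\<close> from the
      torsion hypothesis and the power \<open>N\<close> built into \<psi>.\<close>
    hence "b \<otimes> \<phi> m \<in> Jh"
      using sat[of "r [^] N \<otimes> (b \<otimes> \<phi> m)" n] sat[of "b \<otimes> \<phi> m" N] b \<phi>m rc by simp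
    hence "\<phi> m \<in> colon R Jh b" using R.m_comm[OF b(1) \<phi>m] \<phi>m by (simp add: colon_def)
    thus ?thesis using m by blast
  qed
qed

text \<open>Vanishing on the relations among elements of M makes \<phi>, read on generators, a
  homomorphism from M to R, and the grade hypothesis leaves only zero.\<close>

lemma positive_grade_zero_cocycle:
  assumes pos: "positive_grade R M" and \<phi>: "\<phi> \<in> UNIV \<rightarrow> carrier R"
    and co: "\<And>z. z \<in> syz R M 0 \<Longrightarrow> dot z \<phi> = \<zero>" and m: "m \<in> carrier M"
  shows "\<phi> (Gen m) = \<zero>"
proof -
  have \<phi>c: "\<phi> l \<in> carrier R" for l using \<phi> by auto
  have add: "\<phi> (Gen (x \<oplus>\<^bsub>M\<^esub> a \<odot>\<^bsub>M\<^esub> y)) = \<phi> (Gen x) \<oplus> a \<otimes> \<phi> (Gen y)"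
    if x: "x \<in> carrier M" and y: "y \<in> carrier M" and a: "a \<in> carrier R" for x y a
  proof -
    let ?m = "x \<oplus>\<^bsub>M\<^esub> a \<odot>\<^bsub>M\<^esub> y"
    let ?s = "\<lambda>m a. single (Gen m :: ('a, 'c) label) a"
    define z where "z = (\<lambda>l. ?s ?m (\<ominus> \<one>) l \<oplus> (?s x \<one> l \<oplus> ?s y a l))"
    have s: "?s ?m (\<ominus> \<one>) \<in> finsupp" "?s x \<one> \<in> finsupp" "?s y a \<in> finsupp"
      using a by (simp_all add: finsupp_single)
    have "aug z = (\<ominus> \<one>) \<odot>\<^bsub>M\<^esub> ?m \<oplus>\<^bsub>M\<^esub> (\<one> \<odot>\<^bsub>M\<^esub> x \<oplus>\<^bsub>M\<^esub> a \<odot>\<^bsub>M\<^esub> y)"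
      unfolding z_def aug_add[OF s(1) finsupp_add[OF s(2,3)]] aug_add[OF s(2,3)]
      using x y a by (simp add: aug_single)
    also have "\<dots> = \<zero>\<^bsub>M\<^esub>" using x y a by (simp add: smult_l_minus M.l_neg)
    finally have "z \<in> syz R M 0"
      using s x y a by (auto simp: syz_0_iff z_def finsupp_add single_def split: if_splits)
    hence "dot z \<phi> = \<zero>" by (rule co)
    moreover have "dot z \<phi> = \<ominus> \<phi> (Gen ?m) \<oplus> (\<phi> (Gen x) \<oplus> a \<otimes> \<phi> (Gen y))"
      unfolding z_def dot_add_left[OF s(1) finsupp_add[OF s(2,3)] \<phi>] dot_add_left[OF s(2,3) \<phi>]
      using a \<phi> \<phi>c by (simp add: dot_single_left l_minus)
    ultimately have "\<phi> (Gen x) \<oplus> a \<otimes> \<phi> (Gen y) \<ominus> \<phi> (Gen ?m) = \<zero>"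
      using a \<phi>c by (simp add: a_minus_def R.a_comm)
    thus ?thesis using a \<phi>c by simp
  qed
  have \<phi>0: "\<phi> (Gen \<zero>\<^bsub>M\<^esub>) = \<zero>"
    using add[of "\<zero>\<^bsub>M\<^esub>" "\<zero>\<^bsub>M\<^esub>" \<one>] \<phi>c[of "Gen \<zero>\<^bsub>M\<^esub>"] by simp
  have "(\<lambda>m\<in>carrier M. \<phi> (Gen m)) \<in> carrier (hom_module R M (regular_module R))"
  proof -
    have "\<phi> (Gen (x \<oplus>\<^bsub>M\<^esub> y)) = \<phi> (Gen x) \<oplus> \<phi> (Gen y)" if "x \<in> carrier M" "y \<in> carrier M" for x y
      using add[OF that R.one_closed] that \<phi>c by simp
    moreover have "\<phi> (Gen (a \<odot>\<^bsub>M\<^esub> x)) = a \<otimes> \<phi> (Gen x)" if "a \<in> carrier R" "x \<in> carrier M" for a x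
      using add[OF M.zero_closed that(2,1)] that \<phi>c \<phi>0 by simp
    ultimately show ?thesis using \<phi>c by (auto simp: hom_module_def regular_module_def)
  qed
  hence "(\<lambda>m\<in>carrier M. \<phi> (Gen m)) = \<zero>\<^bsub>hom_module R M (regular_module R)\<^esub>"
    using pos unfolding positive_grade_def by blast
  from fun_cong[OF this, of m] show ?thesis using m by (simp add: hom_module_def regular_module_def)
qed

end

theorem proposition4p4:
  fixes R :: "('a, 'r) ring_scheme" and M :: "('a, 'b, 'm) module_scheme"
  assumes "local_ring R" and "noetherian_ring R"
    and "module R M" and "finitely_generated R M"
    and "positive_grade R M"
  shows "(\<Inter>i\<in>{0::nat<..}. radical R (annihilator R (Ext R i M (regular_module R))))
           = radical R (annihilator R M)"
proof -
  interpret module R M by fact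
  show ?thesis
  proof (intro equalityI subsetI)
    fix r assume r: "r \<in> (\<Inter>i\<in>{0::nat<..}. radical R (annihilator R (Ext R i M (regular_module R))))"
    have Ext: "r \<in> radical R (annihilator R (Ext R (Suc i) M (regular_module R)))" for i
      using r by blast
    have rc: "r \<in> carrier R" using Ext[of 0] by (simp add: radical_def)
    have "ext_torsion r {\<zero>\<^bsub>R\<^esub>}"
      unfolding ext_torsion_def
    proof (intro conjI allI)
      show "\<exists>n::nat. \<forall>\<phi>\<in>UNIV \<rightarrow> carrier R. (\<forall>z\<in>syz R M 0. dot z \<phi> \<in> {\<zero>\<^bsub>R\<^esub>}) \<longrightarrow>
        (\<forall>x\<in>base 0. r [^]\<^bsub>R\<^esub> n \<otimes>\<^bsub>R\<^esub> \<phi> x \<in> {\<zero>\<^bsub>R\<^esub>})"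
      \<comment> \<open>Exponent 0 suffices in degree 0: the cocycles vanish outright.\<close>
      proof (intro exI[of _ 0] ballI impI)
        fix \<phi> :: "('a, 'b) label \<Rightarrow> 'a" and l
        assume \<phi>: "\<phi> \<in> UNIV \<rightarrow> carrier R" "\<forall>z\<in>syz R M 0. dot z \<phi> \<in> {\<zero>\<^bsub>R\<^esub>}" and "l \<in> base 0"
        then obtain m where m: "m \<in> carrier M" "l = Gen m" by auto
        have "dot z \<phi> = \<zero>\<^bsub>R\<^esub>" if "z \<in> syz R M 0" for z using \<phi>(2) that by blast
        hence "\<phi> l = \<zero>\<^bsub>R\<^esub>" unfolding m(2) by (rule positive_grade_zero_cocycle[OF assms(5) \<phi>(1) _ m(1)])
        thus "r [^]\<^bsub>R\<^esub> (0::nat) \<otimes>\<^bsub>R\<^esub> \<phi> l \<in> {\<zero>\<^bsub>R\<^esub>}" by simp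
      qed
    next
      fix i
      obtain n :: nat where n: "r [^]\<^bsub>R\<^esub> n \<in> annihilator R (Ext R (Suc i) M (regular_module R))"
        using Ext[of i] by (auto simp: radical_def)
      show "\<exists>n::nat. \<forall>\<phi>\<in>UNIV \<rightarrow> carrier R. (\<forall>z\<in>syz R M (Suc i). dot z \<phi> \<in> {\<zero>\<^bsub>R\<^esub>}) \<longrightarrow>
        (\<exists>\<psi>\<in>UNIV \<rightarrow> carrier R. \<forall>z\<in>syz R M i.
          r [^]\<^bsub>R\<^esub> n \<otimes>\<^bsub>R\<^esub> \<phi> (rel_label R z) \<ominus>\<^bsub>R\<^esub> dot z \<psi> \<in> {\<zero>\<^bsub>R\<^esub>})"
      proof (intro exI[of _ n] ballI impI)
        fix \<phi> :: "('a, 'b) label \<Rightarrow> 'a"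
        assume \<phi>: "\<phi> \<in> UNIV \<rightarrow> carrier R" "\<forall>z\<in>syz R M (Suc i). dot z \<phi> \<in> {\<zero>\<^bsub>R\<^esub>}"
        hence "\<forall>z\<in>syz R M (Suc i). dot z \<phi> = \<zero>\<^bsub>R\<^esub>" by simp
        from mp[OF bspec[OF conjunct2[OF iffD1[OF mem_annihilator_Ext_iff n]] \<phi>(1)] this]
        obtain \<psi> where \<psi>: "\<psi> \<in> UNIV \<rightarrow> carrier R"
          "\<And>z. z \<in> syz R M i \<Longrightarrow> r [^]\<^bsub>R\<^esub> n \<otimes>\<^bsub>R\<^esub> \<phi> (rel_label R z) = dot z \<psi>"
          by blast
        have "dot z \<psi> \<in> carrier R" if "z \<in> syz R M i" for z
          using dot_closed[OF subsetD[OF syz_finsupp that] \<psi>(1)] .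
        thus "\<exists>\<psi>\<in>UNIV \<rightarrow> carrier R. \<forall>z\<in>syz R M i.
            r [^]\<^bsub>R\<^esub> n \<otimes>\<^bsub>R\<^esub> \<phi> (rel_label R z) \<ominus>\<^bsub>R\<^esub> dot z \<psi> \<in> {\<zero>\<^bsub>R\<^esub>}"
          using \<psi> by (intro bexI[OF _ \<psi>(1)]) (simp add: a_minus_def R.r_neg)
      qed
    qed
    from ext_torsion_imp_power_annihilates[OF assms(2,4) rc this]
    show "r \<in> radical R (annihilator R M)" using rc by (auto simp: radical_def)
  next
    fix r assume r: "r \<in> radical R (annihilator R M)"
    show "r \<in> (\<Inter>i\<in>{0::nat<..}. radical R (annihilator R (Ext R i M (regular_module R))))"
    proof
      fix i :: nat assume "i \<in> {0<..}"
      then obtain j where "i = Suc j" by (cases i) auto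
      thus "r \<in> radical R (annihilator R (Ext R i M (regular_module R)))"
        using r annihilator_subset_annihilator_Ext[of j] by (auto simp: radical_def)
    qed
  qed
qed

end
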